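(* Let $G$ be a finite abelian group and $S=\{s,-s,s',-s',s_0\}\subseteq G\setminus\{0\}$ a generating set of $G$ with $|S|=5$ and $o(s_0)=2$, so that $\Gamma=\mathrm{Cay}(G,S)$ is connected. Put $m=o(s)$, let $l$ be the least positive integer with $ls'\in\langle s\rangle$, and let $h\in\{0,1,\dots,m-1\}$ be the integer with $hs+ls'=0$. Suppose $\Gamma$ admits a perfect code. For $a\in\{-1,1\}$, an integer $i$ and $j\in\{0,1\}$ let $D^{a}(i,j)=\{(3i+ar)s+rs'+(r+j)s_0 : r\in\mathbb{Z}\}$. Write $\tau=\tau(h,l)$ and let $X_1=\mathrm{Cay}(\mathbb{Z}_{ml/\tau}\times\mathbb{Z}_{\tau}\times\mathbb{Z}_2,\{(\pm l/\tau,0,0),\pm(-h/\tau,1,0),(0,0,1)\})$, $X_2=\mathrm{Cay}(\mathbb{Z}_{ml/\tau}\times\mathbb{Z}_{\tau},\{(\pm l/\tau,0),\pm(-h/\tau,1),(ml/(2\tau),0)\})$, $X_3=\mathrm{Cay}(\mathbb{Z}_{ml/\tau}\times\mathbb{Z}_{\tau},\{(\pm l/\tau,0),\pm(-h/\tau,1),(l(m+\mathrm{lcm}(m,h))/(2\tau),l/2)\})$. For $a\in\{-1,1\}$ say that condition $A_a$ holds if $6\mid m$, $3\mid(l-ah)$ and one of: $\Gamma\cong X_1$ and ($\sigma(h)\sigma(l)\neq0$ or $\sigma(m)>\sigma(l-ah)$); $\Gamma\cong X_2$, $\sigma(l)=0$ and $\sigma(m)=\sigma(l-ah)+1$; $\Gamma\cong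 X_3$ and $\sigma(h)\ge\sigma(m)=\sigma(l)=1$. Say that condition $B_a$ holds if $6\mid m$, $3\mid(l-ah)$ and one of: $\Gamma\cong X_2$, $\sigma(h)\sigma(l)\neq0$ and $\sigma(m)\le\sigma(l-ah)$; $\Gamma\cong X_3$ and $\sigma(h)\ge\sigma(m)>\sigma(l)\ge1$. Then: (i) if $I=\{a\in\{-1,1\}: A_a \text{ holds}\}$ is nonempty, the perfect codes of $\Gamma$ containing $0$ are exactly the sets $\bigcup_{i=0}^{\gcd(l-ah,m)/3-1}D^{a}(i,j_i)$ with $a\in I$, $j_0=0$ and $j_i\in\{0,1\}$ arbitrary for $i\ge1$; (ii) if $I=\{a\in\{-1,1\}: B_a \text{ holds}\}$ is nonempty, the perfect codes of $\Gamma$ containing $0$ are exactly the sets $\bigcup_{i=0}^{\gcd(l-ah,m)/6-1}D^{a}(i,j_i)$ with $a\in I$, $j_0=0$ and $j_i\in\{0,1\}$ arbitrary for $i\ge1$.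
   Context: Groups are written additively with identity $0$; $o(x)$ is the order of $x$. For inverse-closed $S\subseteq G\setminus\{0\}$, $\mathrm{Cay}(G,S)$ has vertex set $G$, with $x,y$ adjacent iff $y-x\in S$. A perfect code of a graph is a vertex set $C$ such that every vertex is at distance at most $1$ from exactly one vertex of $C$. For an integer $n$, $\sigma(n)$ is the largest nonnegative integer $i$ with $2^i\mid n$ (with $\sigma(0)=+\infty$). For an integer $n$ and nonzero integer $m$, $\tau(n,m)$ is the least positive integer $j$ (dividing $m$) with $\gcd(n,m/j)=1$. By convention $\mathrm{lcm}(m,0)=0$.
   Formalization: The condition Γ≅X_i is taken to include that τ=τ(h,l) divides h, since otherwise the generator (-h/τ,1) of X_i is undefined (for example h=2, l=4 gives τ=4); the English does not state this divisibility. *)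

theory Defs
  imports
    "HOL-Algebra.Algebra"
    "HOL-Library.Extended_Nat"
    "HOL-Computational_Algebra.Computational_Algebra"
begin

text \<open>
  A graph is given by its vertex set and its (for undirected graphs: symmetric) adjacency relation.
\<close>

record 'v graph =
  vertices :: "'v set"
  adj :: "('v \<times> 'v) set"

definition gdist :: "'v graph \<Rightarrow> 'v \<Rightarrow> 'v \<Rightarrow> enat" where
  "gdist \<Gamma> x y = (INF k \<in> {k. (x, y) \<in> adj \<Gamma> ^^ k}. enat k)"

definition graph_iso :: "'v graph \<Rightarrow> 'w graph \<Rightarrow> bool" where
  "graph_iso \<Gamma> \<Delta> \<longleftrightarrow>
     (\<exists>f. bij_betw f (vertices \<Gamma>) (vertices \<Delta>) \<and>
          (\<forall>x \<in> vertices \<Gamma>. \<forall>y \<in> vertices \<Gamma>. (x, y) \<in> adj \<Gamma> \<longleftrightarrow> (f x, f y) \<in> adj \<Delta>))"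

definition perfect_code :: "'v graph \<Rightarrow> 'v set \<Rightarrow> bool" where
  "perfect_code \<Gamma> C \<longleftrightarrow>
     C \<subseteq> vertices \<Gamma> \<and> (\<forall>x \<in> vertices \<Gamma>. \<exists>!c. c \<in> C \<and> gdist \<Gamma> x c \<le> 1)"

text \<open>
  Abelian groups are taken from HOL-Algebra and are therefore written multiplicatively:
  the difference \<open>y - x\<close> becomes \<open>y \<otimes> inv x\<close>, and \<open>k s\<close> becomes \<open>s [^] k\<close>.
\<close>

definition Cay :: "('g, 'b) monoid_scheme \<Rightarrow> 'g set \<Rightarrow> 'g graph" where
  "Cay G S =
     \<lparr>vertices = carrier G,
      adj = {(x, y). x \<in> carrier G \<and> y \<in> carrier G \<and> y \<otimes>\<^bsub>G\<^esub> inv\<^bsub>G\<^esub> x \<in> S}\<rparr>"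

definition sigma2 :: "int \<Rightarrow> enat" where
  "sigma2 n = (if n = 0 then \<infinity> else enat (multiplicity 2 n))"

definition tau :: "int \<Rightarrow> int \<Rightarrow> nat" where
  "tau n m = (LEAST j. 0 < j \<and> int j dvd m \<and> gcd n (m div int j) = 1)"

text \<open>The residue class of \<open>k\<close> in \<^const>\<open>integer_mod_group\<close> \<open>n\<close>, for \<open>n > 0\<close>.\<close>

definition res :: "nat \<Rightarrow> int \<Rightarrow> int" where
  "res n k = k mod int n"

definition X1 :: "nat \<Rightarrow> nat \<Rightarrow> nat \<Rightarrow> (int \<times> int \<times> int) graph" where
  "X1 m l h =
     (let t = tau (int h) (int l);
          N = m * l div t;
          K = integer_mod_group N \<times>\<times> (integer_mod_group t \<times>\<times> integer_mod_group 2);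
          u = (res N (int (l div t)), res t 0, res 2 0);
          v = (res N (- int (h div t)), res t 1, res 2 0)
      in Cay K {u, inv\<^bsub>K\<^esub> u, v, inv\<^bsub>K\<^esub> v, (res N 0, res t 0, res 2 1)})"

definition X2 :: "nat \<Rightarrow> nat \<Rightarrow> nat \<Rightarrow> (int \<times> int) graph" where
  "X2 m l h =
     (let t = tau (int h) (int l);
          N = m * l div t;
          K = integer_mod_group N \<times>\<times> integer_mod_group t;
          u = (res N (int (l div t)), res t 0);
          v = (res N (- int (h div t)), res t 1)
      in Cay K {u, inv\<^bsub>K\<^esub> u, v, inv\<^bsub>K\<^esub> v, (res N (int (m * l div (2 * t))), res t 0)})"

definition X3 :: "nat \<Rightarrow> nat \<Rightarrow> nat \<Rightarrow> (int \<times> int) graph" where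
  "X3 m l h =
     (let t = tau (int h) (int l);
          N = m * l div t;
          K = integer_mod_group N \<times>\<times> integer_mod_group t;
          u = (res N (int (l div t)), res t 0);
          v = (res N (- int (h div t)), res t 1)
      in Cay K {u, inv\<^bsub>K\<^esub> u, v, inv\<^bsub>K\<^esub> v,
                (res N (int (l * (m + lcm m h) div (2 * t))), res t (int (l div 2)))})"

text \<open>
  By definition \<open>\<tau> = \<tau>(h, l)\<close> divides \<open>l\<close>, but it need not divide \<open>h\<close> (for instance
  \<open>\<tau>(2, 4) = 4\<close>). The generator \<open>(-h/\<tau>, 1)\<close> of the model graphs only makes sense if
  \<open>h/\<tau>\<close> is an integer, so the three predicates below, which say that \<open>\<Gamma>\<close> is isomorphic to the
  respective model graph, include that requirement. The remaining quotients are exact wherever the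
  predicates are used: \<open>m\<close> is then even, and \<open>l\<close> is even for the third graph.
\<close>

definition isoX1 :: "'v graph \<Rightarrow> nat \<Rightarrow> nat \<Rightarrow> nat \<Rightarrow> bool" where
  "isoX1 \<Gamma> m l h \<longleftrightarrow> tau (int h) (int l) dvd h \<and> graph_iso \<Gamma> (X1 m l h)"

definition isoX2 :: "'v graph \<Rightarrow> nat \<Rightarrow> nat \<Rightarrow> nat \<Rightarrow> bool" where
  "isoX2 \<Gamma> m l h \<longleftrightarrow> tau (int h) (int l) dvd h \<and> graph_iso \<Gamma> (X2 m l h)"

definition isoX3 :: "'v graph \<Rightarrow> nat \<Rightarrow> nat \<Rightarrow> nat \<Rightarrow> bool" where
  "isoX3 \<Gamma> m l h \<longleftrightarrow> tau (int h) (int l) dvd h \<and> graph_iso \<Gamma> (X3 m l h)"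

text \<open>In the product \<open>\<sigma>(h) \<sigma>(l)\<close> the convention \<open>\<infinity> * 0 = 0\<close> of \<^typ>\<open>enat\<close> applies.\<close>

definition cond_A :: "'v graph \<Rightarrow> nat \<Rightarrow> nat \<Rightarrow> nat \<Rightarrow> int \<Rightarrow> bool" where
  "cond_A \<Gamma> m l h a \<longleftrightarrow>
     6 dvd m \<and> 3 dvd (int l - a * int h) \<and>
     ((isoX1 \<Gamma> m l h \<and>
         (sigma2 (int h) * sigma2 (int l) \<noteq> 0 \<or> sigma2 (int m) > sigma2 (int l - a * int h))) \<or>
      (isoX2 \<Gamma> m l h \<and> sigma2 (int l) = 0 \<and> sigma2 (int m) = sigma2 (int l - a * int h) + 1) \<or>
      (isoX3 \<Gamma> m l h \<and>
         sigma2 (int h) \<ge> sigma2 (int m) \<and> sigma2 (int m) = sigma2 (int l) \<and> sigma2 (int l) = 1))"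

definition cond_B :: "'v graph \<Rightarrow> nat \<Rightarrow> nat \<Rightarrow> nat \<Rightarrow> int \<Rightarrow> bool" where
  "cond_B \<Gamma> m l h a \<longleftrightarrow>
     6 dvd m \<and> 3 dvd (int l - a * int h) \<and>
     ((isoX2 \<Gamma> m l h \<and>
         sigma2 (int h) * sigma2 (int l) \<noteq> 0 \<and> sigma2 (int m) \<le> sigma2 (int l - a * int h)) \<or>
      (isoX3 \<Gamma> m l h \<and>
         sigma2 (int h) \<ge> sigma2 (int m) \<and> sigma2 (int m) > sigma2 (int l) \<and> sigma2 (int l) \<ge> 1))"

definition Dset :: "('g, 'b) monoid_scheme \<Rightarrow> 'g \<Rightarrow> 'g \<Rightarrow> 'g \<Rightarrow> int \<Rightarrow> int \<Rightarrow> int \<Rightarrow> 'g set" where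
  "Dset G s s' s0 a i j =
     {s [^]\<^bsub>G\<^esub> (3 * i + a * r) \<otimes>\<^bsub>G\<^esub> s' [^]\<^bsub>G\<^esub> r \<otimes>\<^bsub>G\<^esub> s0 [^]\<^bsub>G\<^esub> (r + j) | r :: int. True}"

end

theory Submission
  imports Defs
begin

text \<open>
  Pulling a code back along \<open>(x, y, z) \<mapsto> x s + y s' + z s\<^sub>0\<close> turns perfect codes of \<open>\<Gamma>\<close> into
  tilings of \<open>\<int>\<^sup>2 \<times> \<int>\<^sub>2\<close> by the closed unit ball that are invariant under the kernel \<open>\<Lambda>\<close> of
  this map. A local analysis shows that every tiling through the origin is a union of diagonals
  \<open>x - a y = 3 i\<close> with a common slope \<open>a = \<plusminus>1\<close>, along each of which \<open>z\<close> alternates; so it is given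
  by \<open>a\<close> and the function \<open>f\<close> of starting parities. Invariance under \<open>\<Lambda>\<close> then says that \<open>f\<close> is periodic
  or antiperiodic with period \<open>gcd {u - a v | (u, v, w) \<in> \<Lambda>} / 3\<close>, subject to divisibility by 3 and a
  2-adic compatibility condition.

  The lattice \<open>\<Lambda>\<close> depends on whether \<open>s\<^sub>0\<close> lies outside \<open>\<langle>s, s'\<rangle>\<close>, equals \<open>(m/2) s\<close>, or is of the form
  \<open>x s + (l/2) s'\<close>. The isomorphism type of \<open>\<Gamma>\<close> as a graph does not determine which of these holds, but it
  determines the number of vertices and the number of perfect codes through a vertex. Both
  model graphs of order \<open>m l\<close> are instances of the same situation with the same \<open>m, l, h\<close>, and
  comparing the two numbers of codes slope by slope shows that \<open>\<Gamma>\<close> has the codes of its model.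
\<close>

subsection \<open>Tilings of the lattice\<close>

text \<open>The local analysis rests on one exclusion beyond disjointness of balls: code points at
  \<open>(0, 0)\<close> and \<open>(2, 0)\<close> with opposite heights force two further ones too
  close together. So the cell above or below a horizontal neighbour of a code point is covered from
  a diagonal, which fixes the slope. A kernel vector \<open>(u, v, w)\<close> moves diagonals by
  \<open>(u - a v) / 3\<close> places; as heights alternate along a diagonal, it negates the
  starting parities iff \<open>odd v \<noteq> w\<close>. This is where antiperiodic functions enter.
  The divisors 3 and 6 arise because \<open>gcd (l - a h) m\<close> belongs to the relations between
  \<open>s\<close> and \<open>s'\<close> alone: if \<open>s0\<close> lies in their span, a generator
  is halved, which may or may not halve the gcd. Only the total over both slopes is a graph
  invariant, and nothing ties the slopes of a graph to those of its model. The totals are therefore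
  split by termwise inequalities in one direction; where these are missing, equal totals would force
  equal gcds with different powers of 2.\<close>

definition tiling :: "(int \<Rightarrow> int \<Rightarrow> bool \<Rightarrow> bool) \<Rightarrow> bool" where
  "tiling P \<longleftrightarrow>
     (\<forall>x y z. of_bool (P x y z) + of_bool (P (x + 1) y z) + of_bool (P (x - 1) y z) +
              of_bool (P x (y + 1) z) + of_bool (P x (y - 1) z) + of_bool (P x y (\<not> z)) = (1::nat))"

text \<open>The union of the diagonals \<open>x - a y = 3 i\<close>, where the \<open>i\<close>-th one starts at height \<open>f i\<close>.\<close>

definition pat :: "int \<Rightarrow> (int \<Rightarrow> bool) \<Rightarrow> int \<Rightarrow> int \<Rightarrow> bool \<Rightarrow> bool" where
  "pat a f x y z \<longleftrightarrow> 3 dvd x - a * y \<and> z = (odd y \<noteq> f ((x - a * y) div 3))"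

lemma tilingD:
  assumes "tiling P"
  shows "of_bool (P x y z) + of_bool (P (x + 1) y z) + of_bool (P (x - 1) y z) +
         of_bool (P x (y + 1) z) + of_bool (P x (y - 1) z) + of_bool (P x y (\<not> z)) = (1::nat)"
  using assms unfolding tiling_def by blast

text \<open>Heights are residues modulo 2 stored as Booleans, so their addition is
  \<open>\<noteq>\<close>.\<close>

lemma tiling_translate:
  assumes "tiling P"
  shows "tiling (\<lambda>x y z. P (x + u) (y + v) (z \<noteq> w))"
  unfolding tiling_def
proof (intro allI)
  fix x y z
  have "(\<not> (z \<noteq> w)) = ((\<not> z) \<noteq> w)" by blast
  then show "of_bool (P (x + u) (y + v) (z \<noteq> w)) + of_bool (P (x + 1 + u) (y + v) (z \<noteq> w))
      + of_bool (P (x - 1 + u) (y + v) (z \<noteq> w)) + of_bool (P (x + u) (y + 1 + v) (z \<noteq> w))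
      + of_bool (P (x + u) (y - 1 + v) (z \<noteq> w)) + of_bool (P (x + u) (y + v) ((\<not> z) \<noteq> w)) = (1::nat)"
    using tilingD[OF assms, of "x + u" "y + v" "z \<noteq> w"]
    by (simp add: algebra_simps)
qed

lemma tiling_flip_x:
  assumes "tiling P"
  shows "tiling (\<lambda>x y z. P (- x) y z)"
  unfolding tiling_def
proof (intro allI)
  fix x y z
  have e: "- (x + 1) = - x - 1" "- (x - 1) = - x + 1" for x :: int by auto
  show "of_bool (P (- x) y z) + of_bool (P (- (x + 1)) y z) + of_bool (P (- (x - 1)) y z) +
        of_bool (P (- x) (y + 1) z) + of_bool (P (- x) (y - 1) z) + of_bool (P (- x) y (\<not> z)) = (1::nat)"
    using tilingD[OF assms, of "- x" y z] unfolding e by (simp only: ac_simps)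
qed

lemma tiling_flip_y:
  assumes "tiling P"
  shows "tiling (\<lambda>x y z. P x (- y) z)"
  unfolding tiling_def
proof (intro allI)
  fix x y z
  have e: "- (y + 1) = - y - 1" "- (y - 1) = - y + 1" for y :: int by auto
  show "of_bool (P x (- y) z) + of_bool (P (x + 1) (- y) z) + of_bool (P (x - 1) (- y) z) +
        of_bool (P x (- (y + 1)) z) + of_bool (P x (- (y - 1)) z) + of_bool (P x (- y) (\<not> z)) = (1::nat)"
    using tilingD[OF assms, of x "- y" z] unfolding e by (simp only: ac_simps)
qed

lemma exactly_one_of_six:
  assumes "of_bool a + of_bool b + of_bool c + of_bool d + of_bool e + of_bool f = (1::nat)"
  shows "a \<or> b \<or> c \<or> d \<or> e \<or> f"
    "\<not> (a \<and> b)" "\<not> (a \<and> c)" "\<not> (a \<and> d)" "\<not> (a \<and> e)" "\<not> (a \<and> f)"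
    "\<not> (b \<and> c)" "\<not> (b \<and> d)" "\<not> (b \<and> e)" "\<not> (b \<and> f)" "\<not> (c \<and> d)" "\<not> (c \<and> e)"
    "\<not> (c \<and> f)" "\<not> (d \<and> e)" "\<not> (d \<and> f)" "\<not> (e \<and> f)"
  using assms by (cases a; cases b; cases c; cases d; cases e; cases f; simp)+

lemma tiling_dominated:
  assumes "tiling P"
  shows "P x y z \<or> P (x + 1) y z \<or> P (x - 1) y z \<or> P x (y + 1) z \<or> P x (y - 1) z \<or> P x y (\<not> z)"
  by (rule exactly_one_of_six(1)[OF tilingD[OF assms]])

text \<open>Each listed point shares a ball with the origin, and a ball holds one code point. The
  list contains all points at distance 1 or 2.\<close>

lemma tiling_origin_separated:
  assumes t: "tiling P" and p: "P 0 0 False"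
  shows "\<not> P 1 0 False" "\<not> P (-1) 0 False" "\<not> P 0 1 False" "\<not> P 0 (-1) False" "\<not> P 0 0 True"
    "\<not> P 2 0 False" "\<not> P (-2) 0 False" "\<not> P 0 2 False" "\<not> P 0 (-2) False"
    "\<not> P 1 1 False" "\<not> P 1 (-1) False" "\<not> P (-1) 1 False" "\<not> P (-1) (-1) False"
    "\<not> P 1 0 True" "\<not> P (-1) 0 True" "\<not> P 0 1 True" "\<not> P 0 (-1) True"
proof -
  note o = exactly_one_of_six(2-)[OF tilingD[OF t]]
  show "\<not> P 1 0 False" "\<not> P (-1) 0 False" "\<not> P 0 1 False" "\<not> P 0 (-1) False" "\<not> P 0 0 True"
    using p o(1-5)[of 0 0 False] by auto
  show "\<not> P 2 0 False" "\<not> P 1 1 False" "\<not> P 1 (-1) False" "\<not> P 1 0 True"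
    using p o[of 1 0 False] by auto
  show "\<not> P (-2) 0 False" "\<not> P (-1) 1 False" "\<not> P (-1) (-1) False" "\<not> P (-1) 0 True"
    using p o[of "-1" 0 False] by auto
  show "\<not> P 0 2 False" "\<not> P 0 1 True" using p o[of 0 1 False] by auto
  show "\<not> P 0 (-2) False" "\<not> P 0 (-1) True" using p o[of 0 "-1" False] by auto
qed

lemma tiling_separated:
  assumes t: "tiling P" and p: "P x y z"
  shows "\<not> P (x + 1) y z" "\<not> P (x - 1) y z" "\<not> P x (y + 1) z" "\<not> P x (y - 1) z" "\<not> P x y (\<not> z)"
    "\<not> P (x + 2) y z" "\<not> P (x - 2) y z" "\<not> P x (y + 2) z" "\<not> P x (y - 2) z"
    "\<not> P (x + 1) (y + 1) z" "\<not> P (x + 1) (y - 1) z" "\<not> P (x - 1) (y + 1) z" "\<not> P (x - 1) (y - 1) z"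
    "\<not> P (x + 1) y (\<not> z)" "\<not> P (x - 1) y (\<not> z)" "\<not> P x (y + 1) (\<not> z)" "\<not> P x (y - 1) (\<not> z)"
proof -
  let ?Q = "\<lambda>x' y' z'. P (x' + x) (y' + y) (z' \<noteq> z)"
  have "tiling ?Q" by (rule tiling_translate[OF t])
  moreover have "?Q 0 0 False" using p by simp
  ultimately have *: "\<not> ?Q 1 0 False" "\<not> ?Q (-1) 0 False" "\<not> ?Q 0 1 False" "\<not> ?Q 0 (-1) False" "\<not> ?Q 0 0 True"
    "\<not> ?Q 2 0 False" "\<not> ?Q (-2) 0 False" "\<not> ?Q 0 2 False" "\<not> ?Q 0 (-2) False"
    "\<not> ?Q 1 1 False" "\<not> ?Q 1 (-1) False" "\<not> ?Q (-1) 1 False" "\<not> ?Q (-1) (-1) False"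
    "\<not> ?Q 1 0 True" "\<not> ?Q (-1) 0 True" "\<not> ?Q 0 1 True" "\<not> ?Q 0 (-1) True"
    by (rule tiling_origin_separated[of ?Q])+
  have e: "(False \<noteq> z) = z" "(True \<noteq> z) = (\<not> z)" by auto
  note * = *[unfolded e]
  have c: "1 + x = x + 1" "-1 + x = x - 1" "2 + x = x + 2" "-2 + x = x - 2" "0 + x = x"
    "1 + y = y + 1" "-1 + y = y - 1" "2 + y = y + 2" "-2 + y = y - 2" "0 + y = y" by auto
  note * = *[unfolded c]
  show "\<not> P (x + 1) y z" "\<not> P (x - 1) y z" "\<not> P x (y + 1) z" "\<not> P x (y - 1) z" "\<not> P x y (\<not> z)"
    "\<not> P (x + 2) y z" "\<not> P (x - 2) y z" "\<not> P x (y + 2) z" "\<not> P x (y - 2) z"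
    "\<not> P (x + 1) (y + 1) z" "\<not> P (x + 1) (y - 1) z" "\<not> P (x - 1) (y + 1) z" "\<not> P (x - 1) (y - 1) z"
    "\<not> P (x + 1) y (\<not> z)" "\<not> P (x - 1) y (\<not> z)" "\<not> P x (y + 1) (\<not> z)" "\<not> P x (y - 1) (\<not> z)"
    by (fact *)+
qed

text \<open>If both were code points, \<open>(1, 1)\<close> and \<open>(1, -1)\<close> at height
  \<open>False\<close> could only be covered from \<open>(1, 2)\<close> and \<open>(1, -2)\<close>.
  Then \<open>(0, 1)\<close> and \<open>(0, -1)\<close> at height \<open>True\<close> could only be
  covered from \<open>(-1, 1)\<close> and \<open>(-1, -1)\<close>, which are at distance 2 from each
  other.\<close>

lemma tiling_not_2_0_True:
  assumes t: "tiling P" and p: "P 0 0 False"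
  shows "\<not> P 2 0 True"
proof
  assume q: "P 2 0 True"
  note p0 = tiling_separated[OF t p, simplified] and q0 = tiling_separated[OF t q, simplified]
  have u: "P 1 2 False"
    using tiling_dominated[OF t, of 1 1 False] p0 q0 by auto
  have d: "P 1 (-2) False"
    using tiling_dominated[OF t, of 1 "-1" False] p0 q0 by auto
  note u0 = tiling_separated[OF t u, simplified] and d0 = tiling_separated[OF t d, simplified]
  have "P (-1) 1 True"
    using tiling_dominated[OF t, of 0 1 True] p0 q0 u0 by auto
  note c0 = tiling_separated[OF t this, simplified]
  have "P (-1) (-1) True"
    using tiling_dominated[OF t, of 0 "-1" True] p0 q0 d0 by auto
  with c0 show False by auto
qed

lemma tiling_not_2_0:
  assumes t: "tiling P" and p: "P x y z"
  shows "\<not> P (x + 2) y (\<not> z)"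
  using tiling_not_2_0_True[OF tiling_translate[OF t, of x y z]] p by (simp add: add.commute)

text \<open>With \<open>(2, 0, True)\<close> and \<open>(-2, 0, True)\<close> excluded,
  \<open>(1, 0, True)\<close> and \<open>(-1, 0, True)\<close> can only be covered from diagonal
  neighbours of the origin. Disjointness leaves two opposite corners; which pair occurs is the slope
  at this code point.\<close>

lemma tiling_diagonal_neighbours:
  assumes t: "tiling P" and p: "P 0 0 False"
  shows "P 1 1 True \<and> P (-1) (-1) True \<and> \<not> P 1 (-1) True \<and> \<not> P (-1) 1 True \<or>
         P 1 (-1) True \<and> P (-1) 1 True \<and> \<not> P 1 1 True \<and> \<not> P (-1) (-1) True"
proof -
  note p0 = tiling_separated[OF t p, simplified]
  have r: "\<not> P 2 0 True" by (rule tiling_not_2_0_True[OF t p])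
  have l: "\<not> P (-2) 0 True"
    using tiling_not_2_0_True[OF tiling_flip_x[OF t]] p by simp
  have R: "P 1 1 True \<or> P 1 (-1) True"
    using tiling_dominated[OF t, of 1 0 True] p0 r by auto
  have L: "P (-1) 1 True \<or> P (-1) (-1) True"
    using tiling_dominated[OF t, of "-1" 0 True] p0 l by auto
  have "\<not> (P 1 1 True \<and> P 1 (-1) True)" "\<not> (P 1 1 True \<and> P (-1) 1 True)"
    using tiling_separated[OF t, of 1 1 True, simplified] by auto
  moreover have "\<not> (P (-1) (-1) True \<and> P 1 (-1) True)" "\<not> (P (-1) (-1) True \<and> P (-1) 1 True)"
    using tiling_separated[OF t, of "-1" "-1" True, simplified] by auto
  ultimately show ?thesis using R L by blast
qed

text \<open>The point behind decides between the two alternatives of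
  \<open>tiling_diagonal_neighbours\<close>, so the slope cannot change along a diagonal.\<close>

lemma tiling_direction_propagates:
  assumes t: "tiling P" and p: "P x y z" and q: "P (x - 1) (y - 1) (\<not> z)"
  shows "P (x + 1) (y + 1) (\<not> z)"
proof -
  let ?Q = "\<lambda>x' y' z'. P (x' + x) (y' + y) (z' \<noteq> z)"
  have "tiling ?Q" by (rule tiling_translate[OF t])
  from tiling_diagonal_neighbours[OF this] p q show ?thesis
    by (auto simp: add.commute)
qed

lemma tiling_direction_propagates':
  assumes t: "tiling P" and p: "P x y z" and q: "P (x + 1) (y + 1) (\<not> z)"
  shows "P (x - 1) (y - 1) (\<not> z)"
proof -
  let ?Q = "\<lambda>x' y' z'. P (x' + x) (y' + y) (z' \<noteq> z)"
  have "tiling ?Q" by (rule tiling_translate[OF t])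
  from tiling_diagonal_neighbours[OF this] p q show ?thesis
    by (auto simp: add.commute)
qed

lemma tiling_line:
  assumes t: "tiling P" and p: "P 0 0 False" and q: "P 1 1 True"
  shows "P r r (odd r)"
proof -
  \<comment> \<open>Two consecutive points are carried along, since only a point together with its
    neighbour fixes the direction.\<close>
  have up: "P (int n) (int n) (odd n) \<and> P (int n + 1) (int n + 1) (even n)" for n
  proof (induction n)
    case 0
    then show ?case using p q by simp
  next
    case (Suc n)
    then show ?case
      using tiling_direction_propagates[OF t, of "int n + 1" "int n + 1" "even n"]
      by (auto simp: algebra_simps)
  qed
  have down: "P (- int n) (- int n) (odd n) \<and> P (1 - int n) (1 - int n) (even n)" for n
  proof (induction n)
    case 0
    then show ?case using p q by simp
  next
    case (Suc n)
    have e: "- 1 - int n = - int n - 1" by simp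
    from Suc show ?case
      using tiling_direction_propagates'[OF t, of "- int n" "- int n" "odd n"]
      by (auto simp: algebra_simps e)
  qed
  show ?thesis
  proof (cases "r \<ge> 0")
    case True
    then obtain n where "r = int n" using nonneg_int_cases by blast
    then show ?thesis using up[of n] by simp
  next
    case False
    then obtain n where "r = - int n" by (metis int_cases4 linorder_not_less order_less_imp_le of_nat_0_le_iff)
    then show ?thesis using down[of n] by simp
  qed
qed

definition has_line :: "(int \<Rightarrow> int \<Rightarrow> bool \<Rightarrow> bool) \<Rightarrow> int \<Rightarrow> bool \<Rightarrow> bool" where
  "has_line P i b \<longleftrightarrow> (\<forall>r. P (3 * i + r) r (odd r \<noteq> b))"

lemma alternating_int:
  fixes g :: "int \<Rightarrow> bool"
  assumes "\<And>r. g (r + 1) \<longleftrightarrow> \<not> g r"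
  shows "g r \<longleftrightarrow> (odd r \<noteq> g 0)"
proof (induction r rule: int_induct[where k = 0])
  case (step2 i)
  then show ?case using assms[of "i - 1"] by auto
qed (auto simp: assms)

text \<open>Two consecutive points of the line exclude every cover of the cells over
  \<open>(3 * i + r + 2, r)\<close> except from the columns \<open>(3 * i + r + 3, r)\<close> and
  \<open>(3 * i + r + 2, r - 1)\<close>. Both heights need a cover and a column holds at most one
  code point, so each column holds one, at opposite heights.\<close>

lemma tiling_next_line:
  assumes t: "tiling P" and L: "has_line P i b"
  shows "\<exists>b'. has_line P (i + 1) b'"
proof -
  have ex: "\<exists>c. P (3 * i + r + 3) r c \<and> P (3 * i + r + 2) (r - 1) (\<not> c)" for r
  proof -
    have l1: "P (3 * i + r) r (odd r \<noteq> b)"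
      using L unfolding has_line_def by blast
    have e: "(odd (r + 1) \<noteq> b) = (odd r = b)" "3 * i + (r + 1) = 3 * i + r + 1" by auto
    have l2: "P (3 * i + r + 1) (r + 1) (odd r = b)"
      using L[unfolded has_line_def, rule_format, of "r + 1"] unfolding e .
    note s1 = tiling_separated[OF t l1] and s2 = tiling_separated[OF t l2]
    have e: "(\<not> (odd r \<noteq> b)) = (odd r = b)" by auto
    have n: "\<not> P (3 * i + r + 2) r (odd r = b)"
      using tiling_not_2_0[OF t l1] unfolding e .
    have e: "3 * i + r + 2 - 1 = 3 * i + r + 1" "3 * i + r + 2 + 1 = 3 * i + r + 3" by auto
    have A: "P (3 * i + r + 3) r z \<or> P (3 * i + r + 2) (r - 1) z" for z
      using tiling_dominated[OF t, of "3 * i + r + 2" r z] s1 s2 n unfolding e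
      by (cases "z = (odd r \<noteq> b)") (auto simp: algebra_simps)
    have "\<not> (P (3 * i + r + 3) r True \<and> P (3 * i + r + 3) r False)"
      using tiling_separated(5)[OF t, of "3 * i + r + 3" r True] by auto
    moreover have "\<not> (P (3 * i + r + 2) (r - 1) True \<and> P (3 * i + r + 2) (r - 1) False)"
      using tiling_separated(5)[OF t, of "3 * i + r + 2" "r - 1" True] by auto
    ultimately show ?thesis using A[of True] A[of False] by (metis (full_types))
  qed
  then obtain g where g: "P (3 * i + r + 3) r (g r)" "P (3 * i + r + 2) (r - 1) (\<not> g r)" for r
    by metis
  \<comment> \<open>The second column for \<open>r + 1\<close> is the first column for
    \<open>r\<close>.\<close>
  have alt: "g (r + 1) \<longleftrightarrow> \<not> g r" for r
  proof -
    have "P (3 * i + r + 3) r (\<not> g (r + 1))" using g(2)[of "r + 1"] by (simp add: algebra_simps)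
    with g(1)[of r] tiling_separated(5)[OF t, of "3 * i + r + 3" r "g r"] show ?thesis
      by (cases "g r"; cases "g (r + 1)") auto
  qed
  have "has_line P (i + 1) (g 0)"
    unfolding has_line_def
  proof
    fix r
    show "P (3 * (i + 1) + r) r (odd r \<noteq> g 0)"
      using g(1)[of r] alternating_int[of g r, OF alt] by (simp add: algebra_simps)
  qed
  then show ?thesis by blast
qed

text \<open>A half-turn of the plane sends line \<open>i\<close> to line \<open>- i\<close> and
  keeps the parity of \<open>y\<close>.\<close>

lemma tiling_previous_line:
  assumes t: "tiling P" and L: "has_line P i b"
  shows "\<exists>b'. has_line P (i - 1) b'"
proof -
  let ?Q = "\<lambda>x y z. P (- x) (- y) z"
  have flip: "has_line (\<lambda>x y z. R (- x) (- y) z) (- k) c" if R: "has_line R k c" for R k c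
    unfolding has_line_def
  proof
    fix r
    show "R (- (3 * (- k) + r)) (- r) (odd r \<noteq> c)"
      using R[unfolded has_line_def, rule_format, of "- r"] by simp
  qed
  have "tiling ?Q" using tiling_flip_y[OF tiling_flip_x[OF t]] by simp
  from tiling_next_line[OF this flip[OF L]] obtain b' where "has_line ?Q (- i + 1) b'" by blast
  from flip[OF this] show ?thesis by auto
qed

lemma tiling_all_lines:
  assumes t: "tiling P" and L: "has_line P 0 b"
  shows "\<exists>b'. has_line P i b'"
proof (induction i rule: int_induct[where k = 0])
  case base
  then show ?case using L by blast
next
  case (step1 i)
  then show ?case using tiling_next_line[OF t] by blast
next
  case (step2 i)
  then show ?case using tiling_previous_line[OF t] by blast
qed

text \<open>Only \<open>x - a * y\<close> modulo 3 matters. At residue 0 the centre or its vertical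
  partner is the code point; otherwise two members of the ball lie on the nearest diagonal, with
  \<open>y\<close> of opposite parity, so exactly one of them has height \<open>z\<close>.\<close>

lemma tiling_pat:
  assumes a: "a \<in> {-1, 1}"
  shows "tiling (pat a f)"
  unfolding tiling_def
proof (intro allI)
  fix x y :: int and z
  define w where "w = x - a * y"
  define i where "i = w div 3"
  have "w mod 3 = 0 \<or> w mod 3 = 1 \<or> w mod 3 = 2" by presburger
  then have w: "w = 3 * i \<or> w = 3 * i + 1 \<or> w = 3 * i + 2" unfolding i_def by presburger
  have nd: "\<not> 3 dvd 3 * i + 1" "\<not> 3 dvd 3 * i + 2" "\<not> 3 dvd 3 * i - 1" "\<not> 3 dvd 1 + 3 * i" "\<not> 3 dvd 2 + 3 * i" for i :: int by presburger+
  have q: "(3 * i + 3) div 3 = i + 1" "3 dvd 3 * i + 3" for i :: int by presburger+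
  have x: "x = a * y + w" unfolding w_def by simp
  from a consider "a = 1" | "a = -1" by blast
  then show "of_bool (pat a f x y z) + of_bool (pat a f (x + 1) y z) + of_bool (pat a f (x - 1) y z) +
        of_bool (pat a f x (y + 1) z) + of_bool (pat a f x (y - 1) z) + of_bool (pat a f x y (\<not> z)) = (1::nat)"
  proof cases
    case 1
    from w show ?thesis
      by (elim disjE) (auto simp: pat_def x 1 nd q add.commute[of 1 i])
  next
    case 2
    from w show ?thesis
      by (elim disjE) (auto simp: pat_def x 2 nd q add.commute[of 1 i])
  qed
qed

text \<open>A point of \<open>P\<close> is covered by some point of \<open>Q\<close>, which also
  lies in \<open>P\<close>; by separation the two coincide. So the inclusion given by the lines
  already is equality.\<close>

lemma tiling_subset_eq:
  assumes P: "tiling P" and Q: "tiling Q" and sub: "\<And>x y z. Q x y z \<Longrightarrow> P x y z"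
  shows "P = Q"
proof (intro ext iffI)
  fix x y z
  assume p: "P x y z"
  show "Q x y z"
    using tiling_dominated[OF Q, of x y z] sub tiling_separated[OF P p] by blast
qed (rule sub)

theorem tiling_eq_pat:
  assumes t: "tiling P" and p: "P 0 0 False"
  shows "\<exists>a \<in> {-1, 1}. \<exists>f. \<not> f 0 \<and> P = pat a f"
proof -
  have main: "\<exists>f. \<not> f 0 \<and> R = pat 1 f" if R: "tiling R" "R 0 0 False" "R 1 1 True" for R
  proof -
    have L: "has_line R 0 False" using tiling_line[OF R] by (simp add: has_line_def)
    from tiling_all_lines[OF R(1) L] obtain f where f: "has_line R i (f i)" for i by metis
    have "pat 1 f x y z \<Longrightarrow> R x y z" for x y z
      using f[unfolded has_line_def, rule_format, of "(x - y) div 3" y] by (auto simp: pat_def)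
    then have "R = pat 1 f" by (intro tiling_subset_eq R(1) tiling_pat) auto
    moreover from this have "\<not> f 0" using R(2) by (simp add: pat_def)
    ultimately show ?thesis by blast
  qed
  from tiling_diagonal_neighbours[OF t p] consider "P 1 1 True" | "P 1 (-1) True" by blast
  then show ?thesis
  proof cases
    case 1
    from main[OF t p this] show ?thesis by blast
  next
    case 2
    \<comment> \<open>Slope -1 is slope 1 reflected in \<open>y\<close>, which preserves the parity
      of \<open>y\<close>.\<close>
    then obtain f where f: "\<not> f 0" "(\<lambda>x y z. P x (- y) z) = pat 1 f"
      using main[OF tiling_flip_y[OF t]] p by auto
    have "P = pat (-1) f"
    proof (intro ext)
      fix x y z
      have "P x y z = pat 1 f x (- y) z" using fun_cong[OF fun_cong[OF fun_cong[OF f(2), of x], of "- y"], of z] by simp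
      also have "\<dots> = pat (-1) f x y z" by (simp add: pat_def)
      finally show "P x y z = pat (-1) f x y z" .
    qed
    with f(1) show ?thesis by blast
  qed
qed

subsection \<open>Periodic and antiperiodic functions\<close>

lemma shift_iterate:
  fixes f :: "int \<Rightarrow> bool"
  assumes "\<And>i. f (i + p) \<longleftrightarrow> (f i \<noteq> c)"
  shows "f (i + k * p) \<longleftrightarrow> (f i \<noteq> (odd k \<and> c))"
proof (induction k rule: int_induct[where k = 0])
  case base
  then show ?case by simp
next
  case (step1 k)
  have e: "i + k * p + p = i + (k + 1) * p" "odd (k + 1) \<longleftrightarrow> \<not> odd k" by (simp_all add: algebra_simps)
  show ?case using step1.IH assms[of "i + k * p"] unfolding e by blast
next
  case (step2 k)
  have e: "i + (k - 1) * p + p = i + k * p" "odd (k - 1) \<longleftrightarrow> \<not> odd k" by (simp_all add: algebra_simps)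
  show ?case using step2.IH assms[of "i + (k - 1) * p"] unfolding e by blast
qed

text \<open>Bezout yields a shift by the gcd with some sign \<open>c\<close>. The cofactors are
  coprime, so one of them is odd and transmits \<open>c\<close>; hence \<open>c\<close> is true
  exactly if \<open>c1\<close> or \<open>c2\<close> is.\<close>

lemma shift_pair_iff:
  fixes f :: "int \<Rightarrow> bool" and p q :: int
  assumes "p > 0"
  defines "d \<equiv> gcd p q"
  shows "(\<forall>i. f (i + p) \<longleftrightarrow> (f i \<noteq> c1)) \<and> (\<forall>i. f (i + q) \<longleftrightarrow> (f i \<noteq> c2)) \<longleftrightarrow>
    (c1 \<longleftrightarrow> odd (p div d) \<and> (c1 \<or> c2)) \<and> (c2 \<longleftrightarrow> odd (q div d) \<and> (c1 \<or> c2)) \<and>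
    (\<forall>i. f (i + d) \<longleftrightarrow> (f i \<noteq> (c1 \<or> c2)))"
    (is "?L \<longleftrightarrow> ?R")
proof -
  have d: "d > 0" "p = p div d * d" "q = q div d * d"
    using assms by (auto simp: d_def)
  have cop: "coprime (p div d) (q div d)"
    unfolding d_def using assms(1) by (intro div_gcd_coprime) auto
  have one_odd: "odd (p div d) \<or> odd (q div d)"
    using cop by (meson coprime_common_divisor odd_one)
  show ?thesis
  proof
    assume L: ?L
    obtain u v where uv: "u * p + v * q = d"
      unfolding d_def using bezout_int by blast
    define c where "c \<longleftrightarrow> ((odd u \<and> c1) \<noteq> (odd v \<and> c2))"
    have s: "f (i + d) \<longleftrightarrow> (f i \<noteq> c)" for i
    proof -
      have e: "(i + u * p) + v * q = i + d" using uv by simp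
      have "f (i + u * p) \<longleftrightarrow> (f i \<noteq> (odd u \<and> c1))"
        by (rule shift_iterate) (use L in blast)
      moreover have "f ((i + u * p) + v * q) \<longleftrightarrow> (f (i + u * p) \<noteq> (odd v \<and> c2))"
        by (rule shift_iterate) (use L in blast)
      ultimately show ?thesis unfolding e c_def by blast
    qed
    have c1: "c1 \<longleftrightarrow> odd (p div d) \<and> c"
      using shift_iterate[of f d c 0 "p div d", OF s] L[THEN conjunct1, rule_format, of 0]
      unfolding d(2)[symmetric] by blast
    have c2: "c2 \<longleftrightarrow> odd (q div d) \<and> c"
      using shift_iterate[of f d c 0 "q div d", OF s] L[THEN conjunct2, rule_format, of 0]
      unfolding d(3)[symmetric] by blast
    have "c \<longleftrightarrow> c1 \<or> c2" using c1 c2 one_odd by blast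
    then show ?R using c1 c2 s by simp
  next
    assume R: ?R
    then have s: "f (i + d) \<longleftrightarrow> (f i \<noteq> (c1 \<or> c2))" for i by blast
    have "f (i + p) \<longleftrightarrow> (f i \<noteq> c1)" "f (i + q) \<longleftrightarrow> (f i \<noteq> c2)" for i
      using shift_iterate[of f d "c1 \<or> c2" i "p div d", OF s] shift_iterate[of f d "c1 \<or> c2" i "q div d", OF s]
        R unfolding d(2,3)[symmetric] by blast+
    then show ?L by blast
  qed
qed

text \<open>Division with remainder by \<open>d\<close> leaves the values on
  \<open>{0..d - 1}\<close> free, and the parity of the quotient carries the sign. Fixing
  \<open>f 0\<close> leaves \<open>d - 1\<close> binary choices.\<close>

lemma card_shift_functions:
  fixes d :: int
  assumes "d > 0"
  shows "finite {f :: int \<Rightarrow> bool. \<not> f 0 \<and> (\<forall>i. f (i + d) \<longleftrightarrow> (f i \<noteq> c))}"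
    and "card {f :: int \<Rightarrow> bool. \<not> f 0 \<and> (\<forall>i. f (i + d) \<longleftrightarrow> (f i \<noteq> c))} = 2 ^ (nat d - 1)"
    and "\<exists>f :: int \<Rightarrow> bool. (\<forall>i. f (i + d) \<longleftrightarrow> (f i \<noteq> c)) \<and> (\<forall>i \<in> {0..d - 1}. f i = j i)"
proof -
  let ?Z = "{f :: int \<Rightarrow> bool. \<not> f 0 \<and> (\<forall>i. f (i + d) \<longleftrightarrow> (f i \<noteq> c))}"
  let ?F = "\<lambda>(j :: int \<Rightarrow> bool) i. j (i mod d) \<noteq> (c \<and> odd (i div d))"
  let ?r = "\<lambda>f. {i \<in> {1..<d}. f i}"
  have F: "?F j (i + d) \<longleftrightarrow> (?F j i \<noteq> c)" for j i
  proof -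
    have e: "(i + d) mod d = i mod d" "odd ((i + d) div d) \<longleftrightarrow> \<not> odd (i div d)" using assms by simp_all
    show ?thesis unfolding e by blast
  qed
  show "\<exists>f :: int \<Rightarrow> bool. (\<forall>i. f (i + d) \<longleftrightarrow> (f i \<noteq> c)) \<and> (\<forall>i \<in> {0..d - 1}. f i = j i)"
  proof (intro exI[of _ "?F j"] conjI allI ballI)
    show "?F j i = j i" if "i \<in> {0..d - 1}" for i
    proof -
      have e: "i mod d = i" "odd (i div d) \<longleftrightarrow> False" using that by simp_all
      show ?thesis unfolding e by blast
    qed
  qed (rule F)
  have det: "f i \<longleftrightarrow> (f (i mod d) \<noteq> (odd (i div d) \<and> c))" if "f \<in> ?Z" for f i
  proof -
    have "f (i mod d + i div d * d) \<longleftrightarrow> (f (i mod d) \<noteq> (odd (i div d) \<and> c))"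
      by (rule shift_iterate) (use that in blast)
    then show ?thesis by simp
  qed
  have b: "bij_betw ?r ?Z (Pow {1..<d})"
    unfolding bij_betw_def
  proof
    show "inj_on ?r ?Z"
    proof (rule inj_onI)
      fix f g assume fg: "f \<in> ?Z" "g \<in> ?Z" "?r f = ?r g"
      have "f k = g k" if "k \<in> {0..<d}" for k
        using fg that by (cases "k = 0") (auto simp: set_eq_iff)
      then have "f (i mod d) = g (i mod d)" for i using assms by simp
      then have "f i \<longleftrightarrow> g i" for i using det[OF fg(1), of i] det[OF fg(2), of i] by simp
      then show "f = g" by blast
    qed
    show "?r ` ?Z = Pow {1..<d}"
    proof
      show "Pow {1..<d} \<subseteq> ?r ` ?Z"
      proof
        fix A assume A: "A \<in> Pow {1..<d}"
        let ?f = "?F (\<lambda>i. i \<in> A)"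
        have "?f \<in> ?Z" using F[of "\<lambda>i. i \<in> A"] A assms by auto
        moreover have "?r ?f = A" using A by auto
        ultimately show "A \<in> ?r ` ?Z" by (intro image_eqI[of _ _ ?f]) (rule sym)
      qed
      show "?r ` ?Z \<subseteq> Pow {1..<d}" by (intro image_subsetI PowI Collect_subset)
    qed
  qed
  show "finite ?Z" using bij_betw_finite[OF b] by simp
  show "card ?Z = 2 ^ (nat d - 1)"
    using bij_betw_same_card[OF b] assms by (simp add: card_Pow nat_diff_distrib)
qed

section \<open>Comparing powers of 2 by divisibility\<close>

lemma enat_le_sigma2: "enat k \<le> sigma2 n \<longleftrightarrow> 2 ^ k dvd n"
  by (cases "n = 0") (auto simp: sigma2_def power_dvd_iff_le_multiplicity)

lemma sigma2_le_iff: "sigma2 p \<le> sigma2 q \<longleftrightarrow> (\<forall>k. 2 ^ k dvd p \<longrightarrow> 2 ^ k dvd q)"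
proof
  assume "sigma2 p \<le> sigma2 q"
  then show "\<forall>k. 2 ^ k dvd p \<longrightarrow> 2 ^ k dvd q"
    using order.trans unfolding enat_le_sigma2[symmetric] by blast
next
  assume "\<forall>k. 2 ^ k dvd p \<longrightarrow> 2 ^ k dvd q"
  then have *: "enat k \<le> sigma2 p \<Longrightarrow> enat k \<le> sigma2 q" for k
    unfolding enat_le_sigma2 by blast
  show "sigma2 p \<le> sigma2 q"
  proof (cases "sigma2 p")
    case (enat e)
    with *[of e] show ?thesis by simp
  next
    case infinity
    show ?thesis
    proof (cases "sigma2 q")
      case (enat e)
      with infinity *[of "Suc e"] show ?thesis by simp
    qed auto
  qed
qed

text \<open>The cofactor of \<open>p\<close> is odd iff the gcd contains the full power of 2 of
  \<open>p\<close>. This turns the parity conditions of \<open>shift_pair_iff\<close> into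
  comparisons of \<open>sigma2\<close>.\<close>

lemma odd_div_gcd_iff:
  fixes p q :: int
  assumes "p \<noteq> 0"
  shows "odd (p div gcd p q) \<longleftrightarrow> sigma2 p \<le> sigma2 q"
proof -
  define g where "g = gcd p q"
  define p' q' where "p' = p div g" and "q' = q div g"
  have g: "g \<noteq> 0" "p = g * p'" "q = g * q'"
    using assms by (auto simp: g_def p'_def q'_def)
  have cop: "coprime p' q'"
    unfolding g_def p'_def q'_def using assms by (intro div_gcd_coprime) auto
  have odd_dvd: "2 ^ k dvd g * x \<longleftrightarrow> 2 ^ k dvd g" if "odd x" for k and x :: int
    using that by (simp add: coprime_dvd_mult_left_iff)
  show ?thesis
  proof (cases "odd p'")
    case True
    then show ?thesis
      unfolding g_def[symmetric] p'_def[symmetric] sigma2_le_iff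
      by (auto simp: g(2,3) odd_dvd)
  next
    case False
    then have "odd q'" using cop by (meson coprime_common_divisor odd_one)
    let ?k = "multiplicity 2 g"
    have "2 ^ ?k dvd g" by (rule multiplicity_dvd)
    then have "2 ^ Suc ?k dvd p" using False g(2) by (metis mult_dvd_mono mult.commute power_Suc)
    moreover have "\<not> 2 ^ Suc ?k dvd q"
      unfolding g(3) odd_dvd[OF \<open>odd q'\<close>] using g(1) by (subst power_dvd_iff_le_multiplicity) simp_all
    ultimately show ?thesis
      unfolding g_def[symmetric] p'_def[symmetric] sigma2_le_iff using False by blast
  qed
qed

lemma odd_div_gcd_iff':
  fixes p q :: int
  assumes "p \<noteq> 0"
  shows "odd (q div gcd p q) \<longleftrightarrow> sigma2 q \<le> sigma2 p"
proof (cases "q = 0")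
  case True
  then show ?thesis using assms by (simp add: sigma2_def)
next
  case False
  then show ?thesis using odd_div_gcd_iff[of q p] by (simp add: gcd.commute)
qed

subsection \<open>Perfect codes as tilings\<close>

lemma gdist_le_1_iff: "gdist \<Gamma> x y \<le> 1 \<longleftrightarrow> x = y \<or> (x, y) \<in> adj \<Gamma>"
proof
  let ?K = "{k. (x, y) \<in> adj \<Gamma> ^^ k}"
  assume le: "gdist \<Gamma> x y \<le> 1"
  \<comment> \<open>Without a walk the infimum would be infinity; over a nonempty set it is
    attained, hence is the length of an actual walk.\<close>
  have ne: "enat ` ?K \<noteq> {}"
  proof
    assume "enat ` ?K = {}"
    then have "gdist \<Gamma> x y = \<infinity>" by (simp add: gdist_def top_enat_def)
    with le show False by (simp add: one_enat_def)
  qed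
  then have "Inf (enat ` ?K) \<in> enat ` ?K" by (metis LeastI_ex Inf_enat_def ex_in_conv)
  then obtain k where k: "(x, y) \<in> adj \<Gamma> ^^ k" "enat k = gdist \<Gamma> x y"
    unfolding gdist_def by auto
  with le have "k = 0 \<or> k = 1" by (metis enat_ord_simps(1) one_enat_def le_eq_less_or_eq less_one)
  with k(1) show "x = y \<or> (x, y) \<in> adj \<Gamma>" by auto
next
  assume "x = y \<or> (x, y) \<in> adj \<Gamma>"
  then have "(x, y) \<in> adj \<Gamma> ^^ 0 \<or> (x, y) \<in> adj \<Gamma> ^^ 1" by auto
  then obtain k where k: "(x, y) \<in> adj \<Gamma> ^^ k" "k \<le> 1" by (metis order_refl zero_le_one)
  have "gdist \<Gamma> x y \<le> enat k" unfolding gdist_def using k(1) by (intro INF_lower) simp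
  also have "\<dots> \<le> 1" using k(2) by (simp add: one_enat_def)
  finally show "gdist \<Gamma> x y \<le> 1" .
qed

lemma perfect_code_iff:
  "perfect_code \<Gamma> C \<longleftrightarrow>
     C \<subseteq> vertices \<Gamma> \<and> (\<forall>x \<in> vertices \<Gamma>. \<exists>!c. c \<in> C \<and> (x = c \<or> (x, c) \<in> adj \<Gamma>))"
  by (simp add: perfect_code_def gdist_le_1_iff)

text \<open>\<open>s0_sq\<close> makes \<open>pt\<close> a homomorphism on \<int> x \<int> x
  \<int>\<open>\<^sub>2\<close>. This layer is separate because the model groups reach it before the
  assumptions of \<open>cay5\<close> are proved for them.\<close>

locale cay_gens = comm_group G for G :: "('g, 'b) monoid_scheme" (structure) +
  fixes s s' s0 :: 'g
  assumes mem: "s \<in> carrier G" "s' \<in> carrier G" "s0 \<in> carrier G"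
    and s0_sq: "s0 \<otimes> s0 = \<one>"
begin

definition pt :: "int \<Rightarrow> int \<Rightarrow> bool \<Rightarrow> 'g" where
  "pt i j b = s [^] i \<otimes> s' [^] j \<otimes> (if b then s0 else \<one>)"

lemma pt_closed [simp]: "pt i j b \<in> carrier G"
  using mem by (simp add: pt_def)

lemma pt_mult: "pt i j b \<otimes> pt i' j' b' = pt (i + i') (j + j') (b \<noteq> b')"
proof -
  have e: "(if b then s0 else \<one>) \<otimes> (if b' then s0 else \<one>) = (if b \<noteq> b' then s0 else \<one>)"
    using mem s0_sq by auto
  have c: "(if b then s0 else \<one>) \<in> carrier G" for b using mem by simp
  show ?thesis
    unfolding pt_def e[symmetric] int_pow_mult[OF mem(1)] int_pow_mult[OF mem(2)]
    using mem c[of b] c[of b'] by (simp only: m_ac m_closed int_pow_closed)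
qed

lemma pt_0: "pt 0 0 False = \<one>"
  by (simp add: pt_def)

lemma pt_inv: "inv pt i j b = pt (- i) (- j) b"
  by (rule inv_equality) (auto simp: pt_mult pt_0)

lemma pt_eq_iff: "pt i j b = pt i' j' b' \<longleftrightarrow> pt (i - i') (j - j') (b \<noteq> b') = \<one>"
proof -
  have "pt i j b = pt i' j' b' \<longleftrightarrow> pt i j b \<otimes> inv pt i' j' b' = \<one>"
    by (metis inv_equality inv_inv pt_closed r_inv inv_closed)
  then show ?thesis by (simp add: pt_inv pt_mult)
qed

lemma pt_add_kernel: "pt u v w = \<one> \<Longrightarrow> pt (x + u) (y + v) (z \<noteq> w) = pt x y z"
  using pt_mult[of x y z u v w] by simp

lemma pt_gens:
  "pt 1 0 False = s" "pt (-1) 0 False = inv s" "pt 0 1 False = s'" "pt 0 (-1) False = inv s'"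
  "pt 0 0 True = s0"
proof -
  show 1: "pt 1 0 False = s" "pt 0 1 False = s'" "pt 0 0 True = s0"
    using mem by (auto simp: pt_def)
  show "pt (-1) 0 False = inv s" "pt 0 (-1) False = inv s'"
    using pt_inv[of 1 0 False] pt_inv[of 0 1 False] 1 by simp_all
qed

end

text \<open>The numbers \<open>m\<close>, \<open>l\<close>, \<open>h\<close> enter through the
  kernel at height \<open>False\<close> instead of through orders of elements. In this form the
  given group and its models satisfy the same assumptions with the same numbers.\<close>

locale cay5 = cay_gens G s s' s0 for G :: "('g, 'b) monoid_scheme" (structure) and s s' s0 +
  fixes m l h :: nat
  assumes fin: "finite (carrier G)"
    and m_pos: "m > 0" and l_pos: "l > 0"
    and card5: "card {s, inv s, s', inv s', s0} = 5"
    and one_notin: "\<one> \<notin> {s, inv s, s', inv s', s0}"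
    and pt_surj: "x \<in> carrier G \<Longrightarrow> \<exists>i j b. x = pt i j b"
    and kernel: "pt i j False = \<one> \<longleftrightarrow> int l dvd j \<and> int m dvd i - (j div int l) * int h"
begin

abbreviation "conn \<equiv> {s, inv s, s', inv s', s0}"

abbreviation "\<Gamma> \<equiv> Cay G conn"

lemma neighbourhood:
  assumes "g \<in> carrier G"
  shows "{c. g = c \<or> (g, c) \<in> adj \<Gamma>} = (\<lambda>k. g \<otimes> k) ` insert \<one> conn"
proof -
  have "g = c \<or> (g, c) \<in> adj \<Gamma> \<longleftrightarrow> c \<in> (\<lambda>k. g \<otimes> k) ` insert \<one> conn" for c
  proof -
    have sub: "insert \<one> conn \<subseteq> carrier G" using mem by auto
    have "g = c \<or> (g, c) \<in> adj \<Gamma> \<longleftrightarrow> c \<in> carrier G \<and> c \<otimes> inv g \<in> insert \<one> conn"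
    proof -
      have "c \<otimes> inv g = \<one> \<longleftrightarrow> g = c" if "c \<in> carrier G"
        using assms that by (metis inv_closed inv_equality inv_inv r_inv)
      then show ?thesis using assms unfolding Cay_def by auto
    qed
    also have "\<dots> \<longleftrightarrow> c \<in> (\<lambda>k. g \<otimes> k) ` insert \<one> conn"
    proof
      assume c: "c \<in> carrier G \<and> c \<otimes> inv g \<in> insert \<one> conn"
      then have "c = g \<otimes> (c \<otimes> inv g)"
        using assms by (simp add: m_lcomm[of g c "inv g"])
      then show "c \<in> (\<lambda>k. g \<otimes> k) ` insert \<one> conn" using c by (intro image_eqI) auto
    next
      assume "c \<in> (\<lambda>k. g \<otimes> k) ` insert \<one> conn"
      then obtain k where k: "k \<in> insert \<one> conn" "c = g \<otimes> k" by blast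
      then have kc: "k \<in> carrier G" using sub by blast
      then have "c \<otimes> inv g = k" using assms k(2) by (simp add: m_comm[of g k] m_assoc)
      then show "c \<in> carrier G \<and> c \<otimes> inv g \<in> insert \<one> conn" using k kc assms by simp
    qed
    finally show ?thesis .
  qed
  then show ?thesis by blast
qed

text \<open>By \<open>card5\<close> and \<open>one_notin\<close> the six elements of a closed ball
  are distinct, so \<open>pt\<close> is injective on each lattice ball although it has a kernel.
  Unique covering then is a sum of six indicators.\<close>

lemma perfect_code_iff_tiling:
  "perfect_code \<Gamma> C \<longleftrightarrow> C \<subseteq> carrier G \<and> tiling (\<lambda>x y z. pt x y z \<in> C)"
proof -
  let ?T = "\<lambda>x y z. of_bool (pt x y z \<in> C) + of_bool (pt (x + 1) y z \<in> C) + of_bool (pt (x - 1) y z \<in> C) +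
    of_bool (pt x (y + 1) z \<in> C) + of_bool (pt x (y - 1) z \<in> C) + of_bool (pt x y (\<not> z) \<in> C) = (1::nat)"
  have *: "(\<exists>!c. c \<in> C \<and> (pt x y z = c \<or> (pt x y z, c) \<in> adj \<Gamma>)) \<longleftrightarrow> ?T x y z" for x y z
  proof -
    let ?g = "pt x y z"
    let ?N = "(\<lambda>k. ?g \<otimes> k) ` insert \<one> conn"
    have N: "?g = c \<or> (?g, c) \<in> adj \<Gamma> \<longleftrightarrow> c \<in> ?N" for c
      using neighbourhood[OF pt_closed[of x y z]] by blast
    have Neq: "?N = {pt x y z, pt (x + 1) y z, pt (x - 1) y z, pt x (y + 1) z, pt x (y - 1) z, pt x y (\<not> z)}"
      using pt_mult[of x y z 1 0 False] pt_mult[of x y z "-1" 0 False] pt_mult[of x y z 0 1 False]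
        pt_mult[of x y z 0 "-1" False] pt_mult[of x y z 0 0 True]
      by (simp add: pt_gens)
    have "card ?N = card (insert \<one> conn)"
      using mem by (intro card_image inj_onI) auto
    also have "\<dots> = 6" using one_notin card5 by simp
    finally have dist: "card ?N = 6" .
    have "(\<exists>!c. c \<in> A \<and> c \<in> B) \<longleftrightarrow> is_singleton (A \<inter> B)" for A B :: "'g set"
    proof
      assume "\<exists>!c. c \<in> A \<and> c \<in> B"
      then obtain c where "c \<in> A" "c \<in> B" "\<And>d. d \<in> A \<Longrightarrow> d \<in> B \<Longrightarrow> d = c" by blast
      then have "A \<inter> B = {c}" by blast
      then show "is_singleton (A \<inter> B)" unfolding is_singleton_def by blast
    next
      assume "is_singleton (A \<inter> B)"
      then obtain c where "A \<inter> B = {c}" unfolding is_singleton_def by blast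
      then have "c \<in> A" "c \<in> B" "\<And>d. d \<in> A \<Longrightarrow> d \<in> B \<Longrightarrow> d = c" by blast+
      then show "\<exists>!c. c \<in> A \<and> c \<in> B" by blast
    qed
    then have "(\<exists>!c. c \<in> C \<and> c \<in> ?N) \<longleftrightarrow> is_singleton (C \<inter> ?N)" .
    also have "\<dots> \<longleftrightarrow> card (C \<inter> ?N) = 1" by (rule is_singleton_altdef)
    also have "card (C \<inter> ?N) = (\<Sum>c \<in> ?N. of_bool (c \<in> C))"
    proof -
      have "finite ?N" by simp
      then have "(\<Sum>c \<in> ?N. of_bool (c \<in> C)) = card (?N \<inter> {c. c \<in> C})"
        by (simp only: of_bool_def sum.If_cases) simp
      then show ?thesis by (simp add: Int_commute)
    qed
    also have "\<dots> = of_bool (pt x y z \<in> C) + of_bool (pt (x + 1) y z \<in> C) + of_bool (pt (x - 1) y z \<in> C) +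
      of_bool (pt x (y + 1) z \<in> C) + of_bool (pt x (y - 1) z \<in> C) + of_bool (pt x y (\<not> z) \<in> C)"
    proof -
      have six: "(\<Sum>c \<in> {a1, a2, a3, a4, a5, a6}. F c) = F a1 + F a2 + F a3 + F a4 + F a5 + (F a6 :: nat)"
        if "card {a1, a2, a3, a4, a5, a6} = 6" for F :: "'g \<Rightarrow> nat" and a1 a2 a3 a4 a5 a6
        using that by (simp add: card_insert_if split: if_splits)
      show ?thesis using six[OF dist[unfolded Neq]] unfolding Neq .
    qed
    finally show ?thesis unfolding N .
  qed
  have "(\<forall>g \<in> carrier G. \<exists>!c. c \<in> C \<and> (g = c \<or> (g, c) \<in> adj \<Gamma>)) \<longleftrightarrow> (\<forall>x y z. ?T x y z)"
    unfolding *[symmetric]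
  proof (intro iffI allI ballI)
    fix g assume "\<forall>x y z. \<exists>!c. c \<in> C \<and> (pt x y z = c \<or> (pt x y z, c) \<in> adj \<Gamma>)" "g \<in> carrier G"
    moreover obtain x y z where "g = pt x y z" using pt_surj \<open>g \<in> carrier G\<close> by blast
    ultimately show "\<exists>!c. c \<in> C \<and> (g = c \<or> (g, c) \<in> adj \<Gamma>)" by blast
  next
    fix x y z assume "\<forall>g \<in> carrier G. \<exists>!c. c \<in> C \<and> (g = c \<or> (g, c) \<in> adj \<Gamma>)"
    then show "\<exists>!c. c \<in> C \<and> (pt x y z = c \<or> (pt x y z, c) \<in> adj \<Gamma>)" by (rule bspec) simp
  qed
  then show ?thesis by (simp add: perfect_code_iff tiling_def Cay_def)
qed

definition codes :: "int \<Rightarrow> 'g set set" where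
  "codes a = {C. perfect_code \<Gamma> C \<and> \<one> \<in> C \<and> (\<exists>f. \<forall>x y z. pt x y z \<in> C \<longleftrightarrow> pat a f x y z)}"

lemma perfect_codes_eq: "{C. perfect_code \<Gamma> C \<and> \<one> \<in> C} = codes (-1) \<union> codes 1"
proof -
  have "C \<in> codes (-1) \<union> codes 1" if C: "perfect_code \<Gamma> C" "\<one> \<in> C" for C
  proof -
    let ?P = "\<lambda>x y z. pt x y z \<in> C"
    have t: "tiling ?P" using C(1) perfect_code_iff_tiling by blast
    have "?P 0 0 False" using C(2) by (simp add: pt_0)
    from tiling_eq_pat[OF t this] obtain a f where "a \<in> {-1, 1}" "?P = pat a f" by blast
    then have "C \<in> codes a" "a \<in> {-1, 1}"
      unfolding codes_def using C by (auto simp: fun_eq_iff)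
    then show ?thesis by auto
  qed
  then show ?thesis unfolding codes_def by blast
qed

lemma codes_disjoint: "codes (-1) \<inter> codes 1 = {}"
proof (rule ccontr)
  assume "codes (-1) \<inter> codes 1 \<noteq> {}"
  then obtain C where "C \<in> codes (-1)" "C \<in> codes 1" by blast
  then obtain f f' where f: "\<And>x y z. pt x y z \<in> C \<longleftrightarrow> pat (-1) f x y z"
    and f': "\<And>x y z. pt x y z \<in> C \<longleftrightarrow> pat 1 f' x y z" unfolding codes_def by blast
  \<comment> \<open>Here \<open>x - y\<close> is 0, while \<open>x + y\<close> is 2 and not a
    multiple of 3.\<close>
  have "pt 1 1 (\<not> f' 0) \<in> C" unfolding f' by (simp add: pat_def)
  then show False unfolding f by (simp add: pat_def)
qed

end

section \<open>Codes of one slope as invariant functions\<close>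

context cay5
begin

definition invariant :: "int \<Rightarrow> (int \<Rightarrow> bool) \<Rightarrow> bool" where
  "invariant a f \<longleftrightarrow> (\<forall>x y z. pt x y z = \<one> \<longrightarrow> 3 dvd x - a * y \<and>
     (\<forall>i. f (i + (x - a * y) div 3) \<longleftrightarrow> (f i \<noteq> (odd y \<noteq> z))))"

definition code_of :: "int \<Rightarrow> (int \<Rightarrow> bool) \<Rightarrow> 'g set" where
  "code_of a f = {pt x y z |x y z. pat a f x y z}"

text \<open>Invariance makes \<open>pat a f\<close> constant on the fibres of \<open>pt\<close>, so
  its image pulls back to \<open>pat a f\<close> and nothing more.\<close>

lemma pt_in_code_of:
  assumes "invariant a f"
  shows "pt x y z \<in> code_of a f \<longleftrightarrow> pat a f x y z"
proof
  assume "pt x y z \<in> code_of a f"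
  then obtain x' y' z' where p: "pt x y z = pt x' y' z'" "pat a f x' y' z'"
    unfolding code_of_def by blast
  define u v w where "u = x - x'" and "v = y - y'" and "w \<longleftrightarrow> z \<noteq> z'"
  have k: "pt u v w = \<one>" using p(1) unfolding pt_eq_iff u_def v_def w_def .
  have inv: "3 dvd u - a * v" "\<And>i. f (i + (u - a * v) div 3) \<longleftrightarrow> (f i \<noteq> (odd v \<noteq> w))"
    using assms k unfolding invariant_def by blast+
  obtain t where t: "u - a * v = 3 * t" using inv(1) by blast
  obtain i where i: "x' - a * y' = 3 * i" using p(2) unfolding pat_def by blast
  have "x - a * y = 3 * (i + t)" using t i unfolding u_def v_def by (simp add: algebra_simps)
  moreover have "f (i + t) \<longleftrightarrow> (f i \<noteq> (odd v \<noteq> w))" using inv(2)[of i] t by simp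
  moreover have "odd v \<longleftrightarrow> odd y \<noteq> odd y'" by (simp add: v_def)
  moreover have "z' = (odd y' \<noteq> f i)" using p(2) i by (simp add: pat_def)
  ultimately show "pat a f x y z" unfolding pat_def w_def by auto
qed (auto simp: code_of_def)

lemma codes_eq_image:
  assumes a: "a \<in> {-1, 1}"
  shows "codes a = code_of a ` {f. \<not> f 0 \<and> invariant a f}"
proof (intro equalityI subsetI)
  fix C assume "C \<in> codes a"
  then obtain f where C: "perfect_code \<Gamma> C" "\<one> \<in> C"
    and f: "\<And>x y z. pt x y z \<in> C \<longleftrightarrow> pat a f x y z" unfolding codes_def by blast
  have CC: "C \<subseteq> carrier G" using C(1) perfect_code_iff_tiling by blast
  have f0: "\<not> f 0" using f[of 0 0 False] C(2) by (simp add: pt_0 pat_def)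
  have "invariant a f"
    unfolding invariant_def
  proof (intro allI impI)
    fix u v w assume k: "pt u v w = \<one>"
    have P: "pat a f (x + u) (y + v) (z \<noteq> w) \<longleftrightarrow> pat a f x y z" for x y z
      unfolding f[symmetric] pt_add_kernel[OF k] ..
    have "pat a f 0 0 False" using f0 by (simp add: pat_def)
    with P[of 0 0 False] have d: "3 dvd u - a * v" by (simp add: pat_def)
    then obtain t where t: "u - a * v = 3 * t" by blast
    have "f (i + t) \<longleftrightarrow> (f i \<noteq> (odd v \<noteq> w))" for i
    proof -
      have eq: "3 * i + u - a * v = 3 * (i + t)" using t by simp
      have q: "(3 * i + u - a * v) div 3 = i + t" unfolding eq by simp
      show ?thesis using P[of "3 * i" 0 "f i"] eq by (auto simp: pat_def q)
    qed
    with d t show "3 dvd u - a * v \<and> (\<forall>i. f (i + (u - a * v) div 3) \<longleftrightarrow> (f i \<noteq> (odd v \<noteq> w)))"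
      by simp
  qed
  moreover have "C = code_of a f"
    unfolding code_of_def using CC pt_surj f by blast
  ultimately show "C \<in> code_of a ` {f. \<not> f 0 \<and> invariant a f}" using f0 by blast
next
  fix C assume "C \<in> code_of a ` {f. \<not> f 0 \<and> invariant a f}"
  then obtain f where C: "C = code_of a f" and f0: "\<not> f 0" and inv: "invariant a f" by blast
  have f: "pt x y z \<in> C \<longleftrightarrow> pat a f x y z" for x y z
    unfolding C by (rule pt_in_code_of[OF inv])
  have "(\<lambda>x y z. pt x y z \<in> C) = pat a f" using f by (intro ext)
  moreover have "C \<subseteq> carrier G" unfolding C code_of_def by auto
  ultimately have "perfect_code \<Gamma> C"
    unfolding perfect_code_iff_tiling using tiling_pat[OF a] by simp
  moreover have "\<one> \<in> C" using f[of 0 0 False] f0 by (simp add: pt_0 pat_def)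
  ultimately show "C \<in> codes a" unfolding codes_def using f by blast
qed

text \<open>
  The kernel is generated by \<open>(p, 0, w1)\<close> and \<open>(q, v, w2)\<close>.
\<close>

definition kernel_gens :: "int \<Rightarrow> bool \<Rightarrow> int \<Rightarrow> int \<Rightarrow> bool \<Rightarrow> bool" where
  "kernel_gens p w1 q v w2 \<longleftrightarrow> (\<forall>x y z. pt x y z = \<one> \<longleftrightarrow>
     (\<exists>i j. x = i * p + j * q \<and> y = j * v \<and> z = ((odd i \<and> w1) \<noteq> (odd j \<and> w2))))"

lemma invariance_iff:
  assumes K: "kernel_gens p w1 q v w2"
  shows "invariant a f \<longleftrightarrow>
    3 dvd p \<and> 3 dvd q - a * v \<and> (\<forall>i. f (i + p div 3) \<longleftrightarrow> (f i \<noteq> w1)) \<and>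
    (\<forall>i. f (i + (q - a * v) div 3) \<longleftrightarrow> (f i \<noteq> (odd v \<noteq> w2)))" (is "?L \<longleftrightarrow> ?R")
proof
  assume L: ?L
  have "pt p 0 w1 = \<one>"
    unfolding K[unfolded kernel_gens_def, rule_format] by (intro exI[of _ 1] exI[of _ 0]) simp
  moreover have "pt q v w2 = \<one>"
    unfolding K[unfolded kernel_gens_def, rule_format] by (intro exI[of _ 0] exI[of _ 1]) simp
  ultimately show ?R using L[unfolded invariant_def, rule_format, of p 0 w1] L[unfolded invariant_def, rule_format, of q v w2] by simp
next
  assume R: ?R
  then obtain p' r where p': "p = 3 * p'" and r: "q - a * v = 3 * r" by blast
  have s1: "f (i + p') \<longleftrightarrow> (f i \<noteq> w1)" and s2: "f (i + r) \<longleftrightarrow> (f i \<noteq> (odd v \<noteq> w2))" for i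
    using R unfolding p' r by simp_all
  show ?L
    unfolding invariant_def
  proof (intro allI impI)
    fix x y z assume "pt x y z = \<one>"
    then obtain i j where ij: "x = i * p + j * q" "y = j * v" "z = ((odd i \<and> w1) \<noteq> (odd j \<and> w2))"
      using K unfolding kernel_gens_def by blast
    have e: "x - a * y = 3 * (i * p' + j * r)"
    proof -
      have "x - a * y = i * p + j * (q - a * v)" unfolding ij by (simp add: algebra_simps)
      then show ?thesis unfolding r p' by (simp add: algebra_simps)
    qed
    have "f (k + (i * p' + j * r)) \<longleftrightarrow> (f k \<noteq> (odd y \<noteq> z))" for k
    proof -
      have "f (k + i * p' + j * r) \<longleftrightarrow> (f (k + i * p') \<noteq> (odd j \<and> (odd v \<noteq> w2)))"
        by (rule shift_iterate[of f r "odd v \<noteq> w2", OF s2])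
      moreover have "f (k + i * p') \<longleftrightarrow> (f k \<noteq> (odd i \<and> w1))"
        by (rule shift_iterate[of f p' w1, OF s1])
      ultimately show ?thesis unfolding ij by (auto simp: add.assoc)
    qed
    then show "3 dvd x - a * y \<and> (\<forall>k. f (k + (x - a * y) div 3) \<longleftrightarrow> (f k \<noteq> (odd y \<noteq> z)))"
      unfolding e by simp
  qed
qed

text \<open>
  With \<open>r = q - a v\<close>, the starting parities are shifted by \<open>c1\<close> along \<open>p / 3\<close> and by \<open>c2\<close> along \<open>r / 3\<close>.
  Both shifts come from a shift \<open>c\<close> along the gcd iff \<open>c\<close> survives exactly in the odd multiples, which
  forces \<open>c = (c1 \<or> c2)\<close>.
\<close>

definition ok :: "int \<Rightarrow> bool \<Rightarrow> int \<Rightarrow> bool \<Rightarrow> bool" where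
  "ok p c1 r c2 \<longleftrightarrow> 3 dvd p \<and> 3 dvd r \<and>
     (c1 \<longleftrightarrow> sigma2 p \<le> sigma2 r \<and> (c1 \<or> c2)) \<and> (c2 \<longleftrightarrow> sigma2 r \<le> sigma2 p \<and> (c1 \<or> c2))"

lemma invariance_iff_ok:
  assumes K: "kernel_gens p w1 q v w2" and p: "p > 0"
  shows "invariant a f \<longleftrightarrow>
    ok p w1 (q - a * v) (odd v \<noteq> w2) \<and>
    (\<forall>i. f (i + gcd p (q - a * v) div 3) \<longleftrightarrow> (f i \<noteq> (w1 \<or> (odd v \<noteq> w2))))"
proof (cases "3 dvd p \<and> 3 dvd q - a * v")
  case True
  then obtain p' r where p': "p = 3 * p'" and r: "q - a * v = 3 * r" by blast
  have g: "gcd (3 * p') (3 * r) = 3 * gcd p' r" by (simp add: gcd_mult_distrib_int[symmetric])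
  have "p' > 0" using p p' by simp
  \<comment> \<open>The common factor 3 cancels in the cofactors and does not affect the
    comparisons, so \<open>ok\<close> can speak of the undivided quantities.\<close>
  have e: "odd (p' div gcd p' r) \<longleftrightarrow> sigma2 (3 * p') \<le> sigma2 (3 * r)"
    "odd (r div gcd p' r) \<longleftrightarrow> sigma2 (3 * r) \<le> sigma2 (3 * p')"
    using odd_div_gcd_iff[of "3 * p'" "3 * r"] odd_div_gcd_iff'[of "3 * p'" "3 * r"] \<open>p' > 0\<close>
    unfolding g by simp_all
  show ?thesis
    unfolding invariance_iff[OF K] p' r ok_def g
    using shift_pair_iff[OF \<open>p' > 0\<close>, of f w1 r "odd v \<noteq> w2"] unfolding e by simp
next
  case False
  then show ?thesis unfolding invariance_iff[OF K] ok_def by blast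
qed

lemma codes_empty:
  assumes "kernel_gens p w1 q v w2" "p > 0" "a \<in> {-1, 1}" "\<not> ok p w1 (q - a * v) (odd v \<noteq> w2)"
  shows "codes a = {}"
  unfolding codes_eq_image[OF assms(3)] invariance_iff_ok[OF assms(1,2)] using assms(4) by simp

lemma Dset_eq: "Dset G s s' s0 a i j = {pt (3 * i + a * r) r (odd (r + j)) |r. True}"
proof -
  have "s0 [^] (k :: int) = (if odd k then s0 else \<one>)" for k
  proof -
    have e2: "s0 [^] (2 * t) = \<one>" for t :: int
    proof -
      have "s0 [^] (2 * t) = (s0 [^] (2 :: int)) [^] t" using mem by (simp add: int_pow_pow)
      also have "s0 [^] (2 :: int) = s0 \<otimes> s0"
        using int_pow_mult[OF mem(3), of 1 1] mem by simp
      finally show ?thesis using s0_sq by simp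
    qed
    show ?thesis
    proof (cases "odd k")
      case True
      then obtain t where "k = 2 * t + 1" by (rule oddE)
      then show ?thesis using e2[of t] mem by (simp add: int_pow_mult)
    next
      case False
      then obtain t where "k = 2 * t" by blast
      then show ?thesis using e2[of t] by simp
    qed
  qed
  then show ?thesis unfolding Dset_def pt_def by simp
qed

text \<open>Bezout gives a kernel vector that shifts diagonals by \<open>d\<close> places, so modulo
  the kernel \<open>d\<close> consecutive diagonals represent all of them.\<close>

lemma code_of_eq_Union:
  assumes K: "kernel_gens p w1 q v w2" and p: "p > 0"
    and g: "gcd p (q - a * v) = 3 * d" and inv: "invariant a f"
    and j: "\<And>i. i \<in> {0..d - 1} \<Longrightarrow> odd (j i) = f i"
  shows "code_of a f = (\<Union>i \<in> {0..d - 1}. Dset G s s' s0 a i (j i))"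
proof (intro equalityI subsetI)
  have "gcd p (q - a * v) > 0" using p by simp
  then have d: "d > 0" using g by simp
  fix c assume "c \<in> code_of a f"
  then obtain x y z where c: "c = pt x y z" and P: "pat a f x y z" unfolding code_of_def by blast
  then obtain i where i: "x - a * y = 3 * i" unfolding pat_def by blast
  obtain \<alpha> \<beta> where bezout: "\<alpha> * p + \<beta> * (q - a * v) = 3 * d"
    using bezout_int[of p "q - a * v"] g by auto
  \<comment> \<open>This multiple of the Bezout combination takes diagonal \<open>i\<close> to
    \<open>i mod d\<close>.\<close>
  define t where "t = - (i div d)"
  define u v' w where "u = t * \<alpha> * p + t * \<beta> * q" and "v' = t * \<beta> * v"
    and "w \<longleftrightarrow> (odd (t * \<alpha>) \<and> w1) \<noteq> (odd (t * \<beta>) \<and> w2)"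
  have uv: "u - a * v' = t * (3 * d)"
    unfolding bezout[symmetric] u_def v'_def by (simp add: algebra_simps)
  have k: "pt u v' w = \<one>"
    using K unfolding kernel_gens_def u_def v'_def w_def by blast
  have c': "c = pt (x + u) (y + v') (z \<noteq> w)" unfolding pt_add_kernel[OF k] by (rule c)
  have "pat a f (x + u) (y + v') (z \<noteq> w)"
    using P pt_in_code_of[OF inv, of x y z] pt_in_code_of[OF inv, of "x + u" "y + v'" "z \<noteq> w"]
    unfolding pt_add_kernel[OF k] by simp
  moreover have xy: "x + u - a * (y + v') = 3 * (i mod d)"
  proof -
    have "x + u - a * (y + v') = (x - a * y) + (u - a * v')" by (simp add: algebra_simps)
    also have "\<dots> = 3 * (i + t * d)" unfolding i uv by simp
    also have "i + t * d = i mod d" unfolding t_def by (simp add: minus_div_mult_eq_mod)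
    finally show ?thesis .
  qed
  ultimately have "(z \<noteq> w) = (odd (y + v') \<noteq> f (i mod d))" unfolding pat_def xy by simp
  moreover have "i mod d \<in> {0..d - 1}" using d by simp
  ultimately have zw: "(z \<noteq> w) = odd (y + v' + j (i mod d))" using j by auto
  have xu: "x + u = 3 * (i mod d) + a * (y + v')" using xy by simp
  have "c \<in> Dset G s s' s0 a (i mod d) (j (i mod d))"
    unfolding Dset_eq c' zw xu by blast
  then show "c \<in> (\<Union>i \<in> {0..d - 1}. Dset G s s' s0 a i (j i))"
    using \<open>i mod d \<in> {0..d - 1}\<close> by blast
next
  fix c assume "c \<in> (\<Union>i \<in> {0..d - 1}. Dset G s s' s0 a i (j i))"
  then obtain i r where i: "i \<in> {0..d - 1}" and c: "c = pt (3 * i + a * r) r (odd (r + j i))"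
    unfolding Dset_eq by blast
  have "pat a f (3 * i + a * r) r (odd (r + j i))"
    using j[OF i] by (auto simp: pat_def)
  then show "c \<in> code_of a f" unfolding code_of_def c by blast
qed

lemma codes_ok:
  assumes K: "kernel_gens p w1 q v w2" and p: "p > 0" and a: "a \<in> {-1, 1}"
    and ok: "ok p w1 (q - a * v) (odd v \<noteq> w2)"
  defines "d \<equiv> gcd p (q - a * v) div 3"
  shows "d > 0" "finite (codes a)" "card (codes a) = 2 ^ (nat d - 1)"
    "codes a = {\<Union>i \<in> {0..d - 1}. Dset G s s' s0 a i (j i) | j :: int \<Rightarrow> int. j 0 = 0 \<and> (\<forall>i. j i \<in> {0, 1})}"
proof -
  let ?c = "w1 \<or> (odd v \<noteq> w2)"
  let ?Z = "{f :: int \<Rightarrow> bool. \<not> f 0 \<and> (\<forall>i. f (i + d) \<longleftrightarrow> (f i \<noteq> ?c))}"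
  have "3 dvd gcd p (q - a * v)" using ok unfolding ok_def by simp
  then have d3: "gcd p (q - a * v) = 3 * d" unfolding d_def by simp
  moreover have "gcd p (q - a * v) > 0" using p by simp
  ultimately show d: "d > 0" by simp
  have Z: "invariant a f \<longleftrightarrow> (\<forall>i. f (i + d) \<longleftrightarrow> (f i \<noteq> ?c))" for f
    unfolding invariance_iff_ok[OF K p] d_def using ok by blast
  have img: "codes a = code_of a ` ?Z"
    unfolding codes_eq_image[OF a] Z ..
  have inj: "inj_on (code_of a) ?Z"
  proof (rule inj_onI)
    fix f g assume fg: "f \<in> ?Z" "g \<in> ?Z" "code_of a f = code_of a g"
    then have inv: "invariant a f" "invariant a g" unfolding Z by blast+
    \<comment> \<open>\<open>f i\<close> is the height of the code point over
      \<open>(3 * i, 0)\<close>.\<close>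
    have "f i = g i" for i
    proof -
      have "pat a f (3 * i) 0 (f i)" by (simp add: pat_def)
      then have "pat a g (3 * i) 0 (f i)"
        using pt_in_code_of[OF inv(1)] pt_in_code_of[OF inv(2)] fg(3) by blast
      then show ?thesis by (simp add: pat_def)
    qed
    then show "f = g" by blast
  qed
  show "finite (codes a)" unfolding img using card_shift_functions(1)[OF d] by (rule finite_imageI)
  show "card (codes a) = 2 ^ (nat d - 1)"
    unfolding img card_image[OF inj] by (rule card_shift_functions(2)[OF d])
  show "codes a = {\<Union>i \<in> {0..d - 1}. Dset G s s' s0 a i (j i) | j :: int \<Rightarrow> int. j 0 = 0 \<and> (\<forall>i. j i \<in> {0, 1})}"
  proof (intro equalityI subsetI)
    fix C assume "C \<in> codes a"
    then obtain f where f: "\<not> f 0" "invariant a f" "C = code_of a f"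
      unfolding codes_eq_image[OF a] by blast
    define j :: "int \<Rightarrow> int" where "j = (\<lambda>i. of_bool (f i))"
    have "C = (\<Union>i \<in> {0..d - 1}. Dset G s s' s0 a i (j i))"
      unfolding f(3) by (rule code_of_eq_Union[OF K p d3 f(2)]) (simp add: j_def)
    moreover have "j 0 = 0" "\<forall>i. j i \<in> {0, 1}" using f(1) by (auto simp: j_def)
    ultimately show "C \<in> {\<Union>i \<in> {0..d - 1}. Dset G s s' s0 a i (j i) | j :: int \<Rightarrow> int. j 0 = 0 \<and> (\<forall>i. j i \<in> {0, 1})}"
      by blast
  next
    fix C assume "C \<in> {\<Union>i \<in> {0..d - 1}. Dset G s s' s0 a i (j i) | j :: int \<Rightarrow> int. j 0 = 0 \<and> (\<forall>i. j i \<in> {0, 1})}"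
    then obtain j :: "int \<Rightarrow> int" where C: "C = (\<Union>i \<in> {0..d - 1}. Dset G s s' s0 a i (j i))"
      and j: "j 0 = 0" by blast
    obtain f where f: "\<forall>i. f (i + d) \<longleftrightarrow> (f i \<noteq> ?c)" "\<forall>i \<in> {0..d - 1}. f i = odd (j i)"
      using card_shift_functions(3)[OF d, of ?c "\<lambda>i. odd (j i)"] by blast
    have "\<not> f 0" using f(2) j d by simp
    moreover have "C = code_of a f"
      unfolding C using f(2) by (intro code_of_eq_Union[OF K p d3, symmetric] Z[THEN iffD2, OF f(1)]) simp
    ultimately show "C \<in> codes a" unfolding img using f(1) by blast
  qed
qed

end

section \<open>The kernel for each location of the involution\<close>

context cay5
begin

lemma pt_False_iff: "pt x y False = \<one> \<longleftrightarrow> (\<exists>i j. x = i * int m + j * int h \<and> y = j * int l)"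
proof
  assume "pt x y False = \<one>"
  then obtain i j where "y = int l * j" "x - (y div int l) * int h = int m * i"
    unfolding kernel dvd_def by blast
  then have "x = i * int m + j * int h" "y = j * int l" using l_pos by (simp_all add: algebra_simps)
  then show "\<exists>i j. x = i * int m + j * int h \<and> y = j * int l" by blast
next
  assume "\<exists>i j. x = i * int m + j * int h \<and> y = j * int l"
  then show "pt x y False = \<one>" unfolding kernel using l_pos by auto
qed

lemma pt_True_iff:
  assumes "pt x0 y0 True = \<one>"
  shows "pt x y True = \<one> \<longleftrightarrow> (\<exists>i j. x = x0 + i * int m + j * int h \<and> y = y0 + j * int l)"
proof -
  have "pt x y True = \<one> \<longleftrightarrow> pt (x - x0) (y - y0) False = \<one>"
    using pt_eq_iff[of x y True x0 y0 True] assms by simp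
  also have "\<dots> \<longleftrightarrow> (\<exists>i j. x = x0 + i * int m + j * int h \<and> y = y0 + j * int l)"
    unfolding pt_False_iff by (simp add: algebra_simps)
  finally show ?thesis .
qed

text \<open>Since \<open>s\<^sub>0\<close> is an involution, \<open>pt x y True = \<one>\<close> says that \<open>s\<^sub>0 = x s + y s'\<close>.\<close>

lemma s0_location:
  assumes "pt x y True = \<one>"
  obtains m' where "int m = 2 * m'" "pt m' 0 True = \<one>"
    | x0 l' where "int l = 2 * l'" "pt x0 l' True = \<one>"
proof -
  \<comment> \<open>Doubling lands in the known part of the kernel. Odd \<open>j\<close> halves
    \<open>l\<close>; even \<open>j\<close> removes the \<open>s'\<close>-component, and then odd
    \<open>i\<close> halves \<open>m\<close>, while even \<open>i\<close> would give
    \<open>s0 = \<one>\<close>.\<close>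
  have "pt (x + x) (y + y) False = pt x y True \<otimes> pt x y True" by (simp add: pt_mult)
  then have "pt (x + x) (y + y) False = \<one>" using assms by simp
  then obtain i j where ij: "x + x = i * int m + j * int h" "y + y = j * int l"
    unfolding pt_False_iff by blast
  show thesis
  proof (cases "odd j")
    case True
    then obtain j' where j: "j = 2 * j' + 1" by (rule oddE)
    then have "int l = 2 * (y - j' * int l)" using ij(2) by (simp add: algebra_simps)
    moreover have "pt (x - j' * int h) (y - j' * int l) True = \<one>"
      unfolding pt_True_iff[OF assms] by (intro exI[of _ 0] exI[of _ "- j'"]) simp
    ultimately show thesis by (rule that(2))
  next
    case False
    then obtain j' where j: "j = 2 * j'" by blast
    then have y: "y = j' * int l" using ij(2) by simp
    have p: "pt (x - j' * int h + i' * int m) 0 True = \<one>" for i'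
      unfolding pt_True_iff[OF assms] by (intro exI[of _ i'] exI[of _ "- j'"]) (simp add: y)
    show thesis
    proof (cases "odd i")
      case True
      then obtain i' where i: "i = 2 * i' + 1" by (rule oddE)
      have "int m = 2 * (x - j' * int h + (- i') * int m)" using ij(1) by (simp add: i j algebra_simps)
      from that(1)[OF this p] show thesis .
    next
      case False
      then obtain i' where i: "i = 2 * i'" by blast
      have "x - j' * int h + (- i') * int m = 0" using ij(1) by (simp add: i j algebra_simps)
      with p[of "- i'"] have "pt 0 0 True = \<one>" by simp
      then have "s0 = \<one>" by (simp add: pt_gens)
      with one_notin show thesis by simp
    qed
  qed
qed

lemma kernel_gensI:
  assumes "\<And>x y. pt x y False = \<one> \<longleftrightarrow>
      (\<exists>i j. x = i * p + j * q \<and> y = j * v \<and> ((odd i \<and> w1) \<longleftrightarrow> (odd j \<and> w2)))"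
    and "\<And>x y. pt x y True = \<one> \<longleftrightarrow>
      (\<exists>i j. x = i * p + j * q \<and> y = j * v \<and> ((odd i \<and> w1) \<noteq> (odd j \<and> w2)))"
  shows "kernel_gens p w1 q v w2"
  unfolding kernel_gens_def
proof (intro allI)
  fix x y z
  show "pt x y z = \<one> \<longleftrightarrow>
     (\<exists>i j. x = i * p + j * q \<and> y = j * v \<and> z = ((odd i \<and> w1) \<noteq> (odd j \<and> w2)))"
    by (cases z) (simp_all only: assms simp_thms not_not)
qed

lemma kernel_gens_direct:
  assumes "\<And>x y. pt x y True \<noteq> \<one>"
  shows "kernel_gens m False h l False"
  using assms by (intro kernel_gensI) (auto simp: pt_False_iff)

text \<open>The even multiples of \<open>m'\<close> are the multiples of \<open>m\<close>; the odd
  ones pass through \<open>s0\<close>.\<close>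

lemma kernel_gens_half_m:
  assumes m: "int m = 2 * m'" and k: "pt m' 0 True = \<one>"
  shows "kernel_gens m' True h l False"
proof (rule kernel_gensI)
  fix x y
  show "pt x y False = \<one> \<longleftrightarrow> (\<exists>i j. x = i * m' + j * int h \<and> y = j * int l \<and> (odd i \<and> True \<longleftrightarrow> odd j \<and> False))"
  proof -
    have "(\<exists>i. x = i * int m + c) \<longleftrightarrow> (\<exists>i. x = i * m' + c \<and> even i)" for c
    proof
      assume "\<exists>i. x = i * int m + c"
      then obtain i where "x = i * int m + c" by blast
      then have "x = (2 * i) * m' + c \<and> even (2 * i)" by (simp add: m)
      then show "\<exists>i. x = i * m' + c \<and> even i" by blast
    qed (auto simp: m mult.assoc)
    then show ?thesis unfolding pt_False_iff by auto
  qed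
  show "pt x y True = \<one> \<longleftrightarrow> (\<exists>i j. x = i * m' + j * int h \<and> y = j * int l \<and> (odd i \<and> True) \<noteq> (odd j \<and> False))"
  proof -
    have "(\<exists>i. x = m' + i * int m + c) \<longleftrightarrow> (\<exists>i. x = i * m' + c \<and> odd i)" for c
    proof
      assume "\<exists>i. x = m' + i * int m + c"
      then obtain i where "x = m' + i * int m + c" by blast
      then have "x = (2 * i + 1) * m' + c \<and> odd (2 * i + 1)" by (simp add: m algebra_simps)
      then show "\<exists>i. x = i * m' + c \<and> odd i" by blast
    next
      assume "\<exists>i. x = i * m' + c \<and> odd i"
      then obtain i where "x = (2 * i + 1) * m' + c" by (auto elim!: oddE)
      then have "x = m' + i * int m + c" by (simp add: m algebra_simps)
      then show "\<exists>i. x = m' + i * int m + c" by blast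
    qed
    then show ?thesis unfolding pt_True_iff[OF k] by auto
  qed
qed

text \<open>Twice the relation \<open>(x0, l', True)\<close> is \<open>(h, l, False)\<close> up to a
  multiple of \<open>m\<close>, so the relation replaces the generator \<open>(h, l)\<close>;
  \<open>e\<close> records the correction.\<close>

lemma kernel_gens_half_l:
  assumes l: "int l = 2 * l'" and k: "pt x0 l' True = \<one>"
  shows "kernel_gens m False x0 l' True" "int m dvd 2 * x0 - int h"
proof -
  have "pt (x0 + x0) (l' + l') False = pt x0 l' True \<otimes> pt x0 l' True" by (simp add: pt_mult)
  then have "pt (2 * x0) (int l) False = \<one>" using k l by simp
  then show "int m dvd 2 * x0 - int h" unfolding kernel using l_pos by simp
  then obtain e where e: "2 * x0 = int h + int m * e" by (metis add_diff_cancel_left' diff_eq_eq dvdE add.commute)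
  show "kernel_gens m False x0 l' True"
  proof (rule kernel_gensI)
    fix x y
    show "pt x y False = \<one> \<longleftrightarrow> (\<exists>i j. x = i * int m + j * x0 \<and> y = j * l' \<and> (odd i \<and> False \<longleftrightarrow> odd j \<and> True))"
    proof
      assume "pt x y False = \<one>"
      then obtain i j where "x = i * int m + j * int h" "y = j * int l" unfolding pt_False_iff by blast
      then have "x = (i - j * e) * int m + (2 * j) * x0 \<and> y = (2 * j) * l' \<and> even (2 * j)"
        using e l by (simp add: algebra_simps)
      then show "\<exists>i j. x = i * int m + j * x0 \<and> y = j * l' \<and> (odd i \<and> False \<longleftrightarrow> odd j \<and> True)" by blast
    next
      assume "\<exists>i j. x = i * int m + j * x0 \<and> y = j * l' \<and> (odd i \<and> False \<longleftrightarrow> odd j \<and> True)"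
      then obtain i j where "x = i * int m + (2 * j) * x0" "y = (2 * j) * l'" by auto
      then have "x = (i + j * e) * int m + j * int h \<and> y = j * int l"
        using e l by (simp add: algebra_simps)
      then show "pt x y False = \<one>" unfolding pt_False_iff by blast
    qed
    show "pt x y True = \<one> \<longleftrightarrow> (\<exists>i j. x = i * int m + j * x0 \<and> y = j * l' \<and> (odd i \<and> False) \<noteq> (odd j \<and> True))"
    proof
      assume "pt x y True = \<one>"
      then obtain i j where "x = x0 + i * int m + j * int h" "y = l' + j * int l" unfolding pt_True_iff[OF k] by blast
      then have "x = (i - j * e) * int m + (2 * j + 1) * x0 \<and> y = (2 * j + 1) * l' \<and> odd (2 * j + 1)"
        using e l by (simp add: algebra_simps)
      then show "\<exists>i j. x = i * int m + j * x0 \<and> y = j * l' \<and> (odd i \<and> False) \<noteq> (odd j \<and> True)" by blast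
    next
      assume "\<exists>i j. x = i * int m + j * x0 \<and> y = j * l' \<and> (odd i \<and> False) \<noteq> (odd j \<and> True)"
      then obtain i j where "x = i * int m + (2 * j + 1) * x0" "y = (2 * j + 1) * l'" by (auto elim!: oddE)
      then have "x = x0 + (i + j * e) * int m + j * int h \<and> y = l' + j * int l"
        using e l by (simp add: algebra_simps)
      then show "pt x y True = \<one>" unfolding pt_True_iff[OF k] by blast
    qed
  qed
qed

section \<open>Normal forms and the order of the group\<close>

lemma pt_reduce: "\<exists>i j. pt x y b = pt i j b \<and> i \<in> {0..<int m} \<and> j \<in> {0..<int l}"
proof -
  let ?i = "(x - (y div int l) * int h) mod int m" and ?j = "y mod int l"
  have "pt (x - ?i) (y - ?j) False = \<one>"
    unfolding pt_False_iff
  proof (intro exI conjI)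
    show "x - ?i = ((x - (y div int l) * int h) div int m) * int m + (y div int l) * int h"
      by (simp add: minus_mod_eq_div_mult[symmetric] algebra_simps)
  qed (simp add: minus_mod_eq_div_mult)
  then have "pt x y b = pt ?i ?j b" using pt_eq_iff[of x y b ?i ?j b] by simp
  then show ?thesis using m_pos l_pos by (intro exI[of _ ?i] exI[of _ ?j]) simp
qed

lemma pt_False_reduced_0:
  assumes "pt (i - i') (j - j') False = \<one>"
    and "i \<in> {0..<int m}" "i' \<in> {0..<int m}" "j \<in> {0..<int l}" "j' \<in> {0..<int l}"
  shows "i = i' \<and> j = j'"
proof -
  have small: "d = 0" if "k dvd d" "\<bar>d\<bar> < k" for d k :: int
    using that zdvd_imp_le[of k "\<bar>d\<bar>"] by fastforce
  have "int l dvd j - j'" using assms(1) unfolding kernel by blast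
  then have j: "j - j' = 0" using assms(4,5) by (intro small) auto
  then have "int m dvd i - i'" using assms(1) unfolding kernel by simp
  then have "i - i' = 0" using assms(2,3) by (intro small) auto
  with j show ?thesis by simp
qed

text \<open>Together with \<open>card_carrier_not_direct\<close>, this lets the order decide whether
  \<open>s0\<close> lies in the span of \<open>s\<close> and \<open>s'\<close>.\<close>

lemma card_carrier_direct:
  assumes "\<And>x y. pt x y True \<noteq> \<one>"
  shows "card (carrier G) = 2 * m * l"
proof -
  let ?A = "{0..<int m} \<times> {0..<int l} \<times> (UNIV :: bool set)"
  let ?f = "\<lambda>(i, j, b). pt i j b"
  have "bij_betw ?f ?A (carrier G)"
    unfolding bij_betw_def
  proof
    show "inj_on ?f ?A"
    proof (rule inj_onI)
      fix p q assume pq: "p \<in> ?A" "q \<in> ?A" "?f p = ?f q"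
      obtain i j b where p: "p = (i, j, b)" by (cases p)
      obtain i' j' b' where q: "q = (i', j', b')" by (cases q)
      have r: "i \<in> {0..<int m}" "i' \<in> {0..<int m}" "j \<in> {0..<int l}" "j' \<in> {0..<int l}"
        using pq(1,2) unfolding p q by auto
      have "pt i j b = pt i' j' b'" using pq(3) unfolding p q by simp
      then have k: "pt (i - i') (j - j') (b \<noteq> b') = \<one>" by (simp add: pt_eq_iff)
      then have b: "b = b'" using assms by (metis (full_types))
      with k have "pt (i - i') (j - j') False = \<one>" by simp
      from pt_False_reduced_0[OF this r] b show "p = q" unfolding p q by simp
    qed
    show "?f ` ?A = carrier G"
    proof
      show "carrier G \<subseteq> ?f ` ?A"
      proof
        fix x assume "x \<in> carrier G"
        then obtain i j b where "x = pt i j b" using pt_surj by blast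
        with pt_reduce[of i j b] obtain i' j' where "x = pt i' j' b" "i' \<in> {0..<int m}" "j' \<in> {0..<int l}" by blast
        then show "x \<in> ?f ` ?A" by (intro image_eqI[of _ _ "(i', j', b)"]) auto
      qed
    qed auto
  qed
  from bij_betw_same_card[OF this] show ?thesis by (simp add: card_cartesian_product)
qed

lemma card_carrier_not_direct:
  assumes "pt x0 y0 True = \<one>"
  shows "card (carrier G) = m * l"
proof -
  let ?A = "{0..<int m} \<times> {0..<int l}"
  let ?f = "\<lambda>(i, j). pt i j False"
  have "bij_betw ?f ?A (carrier G)"
    unfolding bij_betw_def
  proof
    show "inj_on ?f ?A"
    proof (rule inj_onI, clarify)
      fix i j i' j'
      assume r: "i \<in> {0..<int m}" "i' \<in> {0..<int m}" "j \<in> {0..<int l}" "j' \<in> {0..<int l}"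
        and "pt i j False = pt i' j' False"
      then have "pt (i - i') (j - j') False = \<one>" by (simp add: pt_eq_iff)
      from pt_False_reduced_0[OF this r] show "i = i' \<and> j = j'" .
    qed
    show "?f ` ?A = carrier G"
    proof
      show "carrier G \<subseteq> ?f ` ?A"
      proof
        fix x assume "x \<in> carrier G"
        then obtain i j b where x: "x = pt i j b" using pt_surj by blast
        have "\<exists>i j. x = pt i j False"
        proof (cases b)
          case True
          then have "x = pt (i + x0) (j + y0) False" using pt_add_kernel[OF assms, of i j True] x by simp
          then show ?thesis by blast
        qed (use x in auto)
        then obtain i j where "x = pt i j False" by blast
        with pt_reduce[of i j False] obtain i' j' where "x = pt i' j' False" "i' \<in> {0..<int m}" "j' \<in> {0..<int l}" by blast
        then show "x \<in> ?f ` ?A" by (intro image_eqI[of _ _ "(i', j')"]) auto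
      qed
    qed auto
  qed
  from bij_betw_same_card[OF this] show ?thesis by (simp add: card_cartesian_product)
qed

end

subsection \<open>Isomorphisms of Cayley graphs\<close>

lemma graph_iso_sym:
  assumes "graph_iso \<Gamma> \<Delta>"
  shows "graph_iso \<Delta> \<Gamma>"
proof -
  obtain f where f: "bij_betw f (vertices \<Gamma>) (vertices \<Delta>)"
    and adj: "\<And>x y. x \<in> vertices \<Gamma> \<Longrightarrow> y \<in> vertices \<Gamma> \<Longrightarrow> (x, y) \<in> adj \<Gamma> \<longleftrightarrow> (f x, f y) \<in> adj \<Delta>"
    using assms unfolding graph_iso_def by blast
  let ?g = "inv_into (vertices \<Gamma>) f"
  have g: "?g x \<in> vertices \<Gamma>" "f (?g x) = x" if "x \<in> vertices \<Delta>" for x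
    using that f by (auto simp: bij_betw_def inv_into_into f_inv_into_f)
  have "\<forall>x \<in> vertices \<Delta>. \<forall>y \<in> vertices \<Delta>. (x, y) \<in> adj \<Delta> \<longleftrightarrow> (?g x, ?g y) \<in> adj \<Gamma>"
    using adj g by simp
  then show ?thesis
    unfolding graph_iso_def using bij_betw_inv_into[OF f] by blast
qed

lemma perfect_code_image:
  assumes f: "bij_betw f (vertices \<Gamma>) (vertices \<Delta>)"
    and adj: "\<And>x y. x \<in> vertices \<Gamma> \<Longrightarrow> y \<in> vertices \<Gamma> \<Longrightarrow> (x, y) \<in> adj \<Gamma> \<longleftrightarrow> (f x, f y) \<in> adj \<Delta>"
    and C: "perfect_code \<Gamma> C"
  shows "perfect_code \<Delta> (f ` C)"
  unfolding perfect_code_iff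
proof (intro conjI ballI)
  have sub: "C \<subseteq> vertices \<Gamma>" using C unfolding perfect_code_iff by blast
  then show "f ` C \<subseteq> vertices \<Delta>" using f unfolding bij_betw_def by blast
  have inj: "f x = f y \<longleftrightarrow> x = y" if "x \<in> vertices \<Gamma>" "y \<in> vertices \<Gamma>" for x y
    using that f unfolding bij_betw_def inj_on_def by blast
  fix y assume "y \<in> vertices \<Delta>"
  then obtain x where x: "x \<in> vertices \<Gamma>" "y = f x" using f unfolding bij_betw_def by blast
  then obtain c where c: "c \<in> C" "x = c \<or> (x, c) \<in> adj \<Gamma>"
    and unique: "\<And>d. d \<in> C \<Longrightarrow> x = d \<or> (x, d) \<in> adj \<Gamma> \<Longrightarrow> d = c"
    using C unfolding perfect_code_iff by blast
  show "\<exists>!d. d \<in> f ` C \<and> (y = d \<or> (y, d) \<in> adj \<Delta>)"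
  proof (intro ex1I[of _ "f c"] conjI)
    show "y = f c \<or> (y, f c) \<in> adj \<Delta>" using c x adj sub by blast
    fix d assume d: "d \<in> f ` C \<and> (y = d \<or> (y, d) \<in> adj \<Delta>)"
    then obtain d' where d': "d' \<in> C" "d = f d'" by blast
    then have "d' \<in> vertices \<Gamma>" using sub by blast
    then have "x = d' \<or> (x, d') \<in> adj \<Gamma>" using d d'(2) x adj inj by auto
    then show "d = f c" using unique d' by blast
  qed (use c in blast)
qed

text \<open>Translations are automorphisms of a Cayley graph, so one can be composed with the
  isomorphism. Codes through the identity then correspond to codes through the identity.\<close>

lemma Cay_iso_fixing_one:
  assumes G: "comm_group G" and K: "comm_group K" and iso: "graph_iso (Cay G S) (Cay K T)"
  obtains f where "bij_betw f (carrier G) (carrier K)" "f \<one>\<^bsub>G\<^esub> = \<one>\<^bsub>K\<^esub>"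
    "\<And>x y. x \<in> carrier G \<Longrightarrow> y \<in> carrier G \<Longrightarrow> (x, y) \<in> adj (Cay G S) \<longleftrightarrow> (f x, f y) \<in> adj (Cay K T)"
proof -
  interpret G: comm_group G by (rule G)
  interpret K: comm_group K by (rule K)
  obtain f where f: "bij_betw f (carrier G) (carrier K)"
    and adj: "\<And>x y. x \<in> carrier G \<Longrightarrow> y \<in> carrier G \<Longrightarrow> (x, y) \<in> adj (Cay G S) \<longleftrightarrow> (f x, f y) \<in> adj (Cay K T)"
    using iso unfolding graph_iso_def by (auto simp: Cay_def)
  define a where "a = inv\<^bsub>K\<^esub> f \<one>\<^bsub>G\<^esub>"
  have fK: "f x \<in> carrier K" if "x \<in> carrier G" for x using f that unfolding bij_betw_def by blast
  then have a: "a \<in> carrier K" unfolding a_def by simp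
  have tr: "bij_betw (\<lambda>x. x \<otimes>\<^bsub>K\<^esub> a) (carrier K) (carrier K)"
  proof (rule bij_betwI[of _ _ _ "\<lambda>x. x \<otimes>\<^bsub>K\<^esub> inv\<^bsub>K\<^esub> a"])
  qed (use a in \<open>auto simp: K.m_assoc\<close>)
  have tr_adj: "(x \<otimes>\<^bsub>K\<^esub> a, y \<otimes>\<^bsub>K\<^esub> a) \<in> adj (Cay K T) \<longleftrightarrow> (x, y) \<in> adj (Cay K T)"
    if "x \<in> carrier K" "y \<in> carrier K" for x y
  proof -
    have "(y \<otimes>\<^bsub>K\<^esub> a) \<otimes>\<^bsub>K\<^esub> inv\<^bsub>K\<^esub> (x \<otimes>\<^bsub>K\<^esub> a) = y \<otimes>\<^bsub>K\<^esub> (a \<otimes>\<^bsub>K\<^esub> inv\<^bsub>K\<^esub> a) \<otimes>\<^bsub>K\<^esub> inv\<^bsub>K\<^esub> x"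
      using that a by (simp only: K.inv_mult_group K.m_assoc K.inv_closed K.m_closed)
    then show ?thesis using that a by (simp add: Cay_def)
  qed
  show thesis
  proof (rule that[of "\<lambda>x. f x \<otimes>\<^bsub>K\<^esub> a"])
    show "bij_betw (\<lambda>x. f x \<otimes>\<^bsub>K\<^esub> a) (carrier G) (carrier K)"
      using bij_betw_trans[OF f tr] by (simp add: comp_def)
    show "f \<one>\<^bsub>G\<^esub> \<otimes>\<^bsub>K\<^esub> a = \<one>\<^bsub>K\<^esub>" using fK unfolding a_def by simp
    show "(x, y) \<in> adj (Cay G S) \<longleftrightarrow> (f x \<otimes>\<^bsub>K\<^esub> a, f y \<otimes>\<^bsub>K\<^esub> a) \<in> adj (Cay K T)"
      if "x \<in> carrier G" "y \<in> carrier G" for x y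
      using adj[OF that] tr_adj fK that by simp
  qed
qed

lemma Cay_iso_card_codes_le:
  assumes G: "comm_group G" and K: "comm_group K" and iso: "graph_iso (Cay G S) (Cay K T)"
    and fin: "finite (carrier K)"
  shows "card {C. perfect_code (Cay G S) C \<and> \<one>\<^bsub>G\<^esub> \<in> C} \<le> card {C. perfect_code (Cay K T) C \<and> \<one>\<^bsub>K\<^esub> \<in> C}"
    (is "card ?A \<le> card ?B")
proof -
  obtain f where f: "bij_betw f (carrier G) (carrier K)" "f \<one>\<^bsub>G\<^esub> = \<one>\<^bsub>K\<^esub>"
    and adj: "\<And>x y. x \<in> carrier G \<Longrightarrow> y \<in> carrier G \<Longrightarrow> (x, y) \<in> adj (Cay G S) \<longleftrightarrow> (f x, f y) \<in> adj (Cay K T)"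
    using Cay_iso_fixing_one[OF G K iso] by blast
  have v: "vertices (Cay G S) = carrier G" "vertices (Cay K T) = carrier K" by (simp_all add: Cay_def)
  show ?thesis
  proof (rule card_inj_on_le[of "image f"])
    have "?A \<subseteq> Pow (carrier G)" unfolding perfect_code_iff v by blast
    then show "inj_on (image f) ?A"
      using f(1) inj_on_image_Pow inj_on_subset unfolding bij_betw_def by metis
    show "image f ` ?A \<subseteq> ?B"
    proof (intro image_subsetI CollectI conjI)
      fix C assume C: "C \<in> ?A"
      then show "perfect_code (Cay K T) (f ` C)"
        using perfect_code_image[of f "Cay G S" "Cay K T", unfolded v, OF f(1) adj] by blast
      show "\<one>\<^bsub>K\<^esub> \<in> f ` C" using C imageI[of "\<one>\<^bsub>G\<^esub>" C f] f(2) by simp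
    qed
    have "?B \<subseteq> Pow (carrier K)" unfolding perfect_code_iff v by blast
    then show "finite ?B" using fin finite_subset by blast
  qed
qed

lemma Cay_iso_card_codes:
  assumes "comm_group G" "comm_group K" "graph_iso (Cay G S) (Cay K T)"
    "finite (carrier G)" "finite (carrier K)"
  shows "card {C. perfect_code (Cay G S) C \<and> \<one>\<^bsub>G\<^esub> \<in> C} = card {C. perfect_code (Cay K T) C \<and> \<one>\<^bsub>K\<^esub> \<in> C}"
  by (rule antisym[OF Cay_iso_card_codes_le[OF assms(1-3,5)]
        Cay_iso_card_codes_le[OF assms(2,1) graph_iso_sym[OF assms(3)] assms(4)]])

text \<open>The connection set is the set of neighbours of the identity. This carries over to a
  model that its five generators are distinct and nontrivial, which its formulas do not
  show.\<close>

lemma Cay_iso_connection_set: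
  assumes G: "comm_group G" and K: "comm_group K" and iso: "graph_iso (Cay G S) (Cay K T)"
    and S: "S \<subseteq> carrier G" and T: "T \<subseteq> carrier K"
  shows "card T = card S" "\<one>\<^bsub>K\<^esub> \<in> T \<longleftrightarrow> \<one>\<^bsub>G\<^esub> \<in> S"
proof -
  interpret G: comm_group G by (rule G)
  interpret K: comm_group K by (rule K)
  obtain f where f: "bij_betw f (carrier G) (carrier K)" "f \<one>\<^bsub>G\<^esub> = \<one>\<^bsub>K\<^esub>"
    and adj: "\<And>x y. x \<in> carrier G \<Longrightarrow> y \<in> carrier G \<Longrightarrow> (x, y) \<in> adj (Cay G S) \<longleftrightarrow> (f x, f y) \<in> adj (Cay K T)"
    using Cay_iso_fixing_one[OF G K iso] by blast
  have fT: "x \<in> S \<longleftrightarrow> f x \<in> T" if "x \<in> carrier G" for x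
  proof -
    have "f x \<in> carrier K" using that f(1) unfolding bij_betw_def by blast
    then show ?thesis using adj[OF G.one_closed that] that by (simp add: Cay_def f(2))
  qed
  show "\<one>\<^bsub>K\<^esub> \<in> T \<longleftrightarrow> \<one>\<^bsub>G\<^esub> \<in> S" using fT[of "\<one>\<^bsub>G\<^esub>"] f(2) by simp
  have "f ` S = T"
  proof
    show "T \<subseteq> f ` S"
    proof
      fix t assume t: "t \<in> T"
      then obtain x where "x \<in> carrier G" "t = f x" using T f(1) unfolding bij_betw_def by blast
      then show "t \<in> f ` S" using fT t by blast
    qed
  qed (use fT S in blast)
  moreover have "inj_on f S" using f(1) S unfolding bij_betw_def by (blast intro: inj_on_subset)
  ultimately show "card T = card S" using card_image by blast
qed

lemma Cay_iso_card_carrier: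
  assumes "graph_iso (Cay G S) (Cay K T)"
  shows "card (carrier G) = card (carrier K)"
proof -
  obtain f where "bij_betw f (carrier G) (carrier K)"
    using assms unfolding graph_iso_def by (auto simp: Cay_def)
  then show ?thesis by (rule bij_betw_same_card)
qed

lemma int_pow_DirProd:
  assumes "group G" "group H" "x \<in> carrier G" "y \<in> carrier H"
  shows "(x, y) [^]\<^bsub>G \<times>\<times> H\<^esub> (k :: int) = (x [^]\<^bsub>G\<^esub> k, y [^]\<^bsub>H\<^esub> k)"
proof -
  have n: "(x, y) [^]\<^bsub>G \<times>\<times> H\<^esub> (n :: nat) = (x [^]\<^bsub>G\<^esub> n, y [^]\<^bsub>H\<^esub> n)" for n
    by (induction n) (simp_all add: DirProd_def)
  have "x [^]\<^bsub>G\<^esub> n \<in> carrier G" "y [^]\<^bsub>H\<^esub> n \<in> carrier H" for n :: nat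
    using assms by (simp_all add: group.is_monoid monoid.nat_pow_closed)
  then have "inv\<^bsub>G \<times>\<times> H\<^esub> (x [^]\<^bsub>G\<^esub> n, y [^]\<^bsub>H\<^esub> n) = (inv\<^bsub>G\<^esub> (x [^]\<^bsub>G\<^esub> n), inv\<^bsub>H\<^esub> (y [^]\<^bsub>H\<^esub> n))" for n :: nat
    using assms by (intro inv_DirProd) auto
  then show ?thesis unfolding int_pow_def2 n by (simp only: if_distrib split: if_split) simp
qed

lemma tau_props:
  assumes "l > 0"
  shows "tau h l > 0" "int (tau h l) dvd l" "coprime h (l div int (tau h l))"
proof -
  let ?P = "\<lambda>j::nat. 0 < j \<and> int j dvd l \<and> gcd h (l div int j) = 1"
  \<comment> \<open>The minimum exists, since \<open>j = l\<close> leaves the quotient 1.\<close>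
  have "?P (nat l)" using assms by simp
  then have "?P (tau h l)" unfolding tau_def by (rule LeastI)
  then show "tau h l > 0" "int (tau h l) dvd l" "coprime h (l div int (tau h l))"
    by (auto simp: coprime_iff_gcd_eq_1)
qed

subsection \<open>The model graphs\<close>

text \<open>The left side is the kernel of \<open>pt\<close> at height \<open>False\<close> in a
  model, the right side the one demanded by \<open>cay5\<close>, with \<open>l = t * L\<close> and
  \<open>h = t * H\<close>. The coprimality ensured by \<open>tau\<close> forces \<open>L\<close> to
  divide \<open>j div t\<close>.\<close>

lemma residue_pairs_kernel:
  fixes i j m L H t :: int
  assumes "t > 0" "L > 0" "m > 0" and cop: "coprime (t * H) L"
  shows "m * L dvd i * L - j * H \<and> t dvd j \<longleftrightarrow> t * L dvd j \<and> m dvd i - (j div (t * L)) * (t * H)"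
proof
  assume A: "m * L dvd i * L - j * H \<and> t dvd j"
  then obtain j' where j': "j = t * j'" by blast
  have "L dvd i * L - j * H" using A dvd_mult_right by blast
  then have "L dvd i * L - (i * L - j * H)" by (rule dvd_diff[OF dvd_triv_right])
  then have "L dvd j * H" by simp
  then have "L dvd (t * H) * j'" unfolding j' by (simp add: ac_simps)
  then have "L dvd j'" using cop by (simp add: coprime_dvd_mult_right_iff coprime_commute)
  then obtain q where q: "j' = L * q" by blast
  have "L * m dvd L * (i - q * (t * H))"
    using A unfolding j' q by (simp add: algebra_simps)
  then have "m dvd i - q * (t * H)" using assms(2) by simp
  moreover have "j div (t * L) = q" using assms unfolding j' q by simp
  ultimately show "t * L dvd j \<and> m dvd i - (j div (t * L)) * (t * H)"
    unfolding j' q by simp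
next
  assume A: "t * L dvd j \<and> m dvd i - (j div (t * L)) * (t * H)"
  then obtain q where q: "j = t * L * q" by blast
  have "j div (t * L) = q" using assms unfolding q by simp
  then have "m dvd i - q * (t * H)" using A by simp
  then have "m * L dvd (i - q * (t * H)) * L" by simp
  then show "m * L dvd i * L - j * H \<and> t dvd j" unfolding q by (simp add: algebra_simps)
qed

text \<open>One treatment of both models of order \<open>m * l\<close>: \<open>A\<close> and
  \<open>B\<close> are the coordinates of the involution, and the divisibilities say that its double
  vanishes. The isomorphism supplies distinctness of the generators.\<close>

lemma model_cay5:
  fixes G :: "('g, 'b) monoid_scheme" and A B :: int
  assumes G: "cay5 G s s' s0 m l h"
  defines "t \<equiv> tau (int h) (int l)"
  defines "N \<equiv> m * l div t"
  defines "K \<equiv> integer_mod_group N \<times>\<times> integer_mod_group t"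
  defines "u \<equiv> (res N (int (l div t)), res t 0)"
  defines "v \<equiv> (res N (- int (h div t)), res t 1)"
  defines "w \<equiv> (res N A, res t B)"
  assumes th: "t dvd h" and AB: "int N dvd 2 * A" "int t dvd 2 * B"
    and iso: "graph_iso (Cay G {s, inv\<^bsub>G\<^esub> s, s', inv\<^bsub>G\<^esub> s', s0}) (Cay K {u, inv\<^bsub>K\<^esub> u, v, inv\<^bsub>K\<^esub> v, w})"
  shows "cay5 K u v w m l h"
    and "\<And>i j. int N dvd i * int (l div t) - j * int (h div t) + A \<Longrightarrow> int t dvd j + B \<Longrightarrow>
           cay_gens.pt K u v w i j True = \<one>\<^bsub>K\<^esub>"
    and "card (carrier G) = m * l"
    and "card {C. perfect_code (Cay G {s, inv\<^bsub>G\<^esub> s, s', inv\<^bsub>G\<^esub> s', s0}) C \<and> \<one>\<^bsub>G\<^esub> \<in> C} =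
         card {C. perfect_code (Cay K {u, inv\<^bsub>K\<^esub> u, v, inv\<^bsub>K\<^esub> v, w}) C \<and> \<one>\<^bsub>K\<^esub> \<in> C}"
proof -
  interpret G: cay5 G s s' s0 m l h by (rule G)
  have pos: "m > 0" "l > 0" using G.m_pos G.l_pos by auto
  have t: "t > 0" "int t dvd int l" "coprime (int h) (int l div int t)"
    unfolding t_def using tau_props[of "int l" "int h"] pos by auto
  define L H where "L = l div t" and "H = h div t"
  have tl: "t dvd l" using t(2) by simp
  have lL: "l = t * L" and hH: "h = t * H" using tl th unfolding L_def H_def by simp_all
  have L: "L > 0" using pos(2) lL by (cases L) auto
  have N: "N = m * L" "N > 0" using t(1) pos(1) L unfolding N_def lL by auto
  have cop: "coprime (int t * int H) (int L)" using t(3) by (simp add: L_def hH zdiv_int[symmetric])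
  have K: "comm_group K" unfolding K_def
    by (rule group.group_comm_groupI[OF DirProd_group]) (auto simp: add.commute)
  have one: "\<one>\<^bsub>K\<^esub> = (0, 0)" by (simp add: K_def DirProd_def)
  have carrier: "carrier K = {0..<int N} \<times> {0..<int t}"
    using N(2) t(1) by (simp add: K_def carrier_integer_mod_group)
  have mult: "(x, y) \<otimes>\<^bsub>K\<^esub> (x', y') = (res N (x + x'), res t (y + y'))" for x y x' y'
    by (simp add: K_def res_def DirProd_def)
  have mem: "(res N x, res t y) \<in> carrier K" for x y
    using N(2) t(1) by (simp add: carrier res_def)
  have pow: "(res N x, res t y) [^]\<^bsub>K\<^esub> (k :: int) = (res N (k * x), res t (k * y))" for x y k
  proof -
    have "(res N x, res t y) [^]\<^bsub>K\<^esub> k = (res N x [^]\<^bsub>integer_mod_group N\<^esub> k, res t y [^]\<^bsub>integer_mod_group t\<^esub> k)"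
      using mem[of x y] unfolding K_def by (intro int_pow_DirProd) auto
    then show ?thesis by (simp add: int_pow_integer_mod_group res_def mod_mult_right_eq)
  qed
  have res_add: "res n (res n x + res n y) = res n (x + y)" for n x y
    by (simp add: res_def mod_add_eq)
  have w2: "w \<otimes>\<^bsub>K\<^esub> w = \<one>\<^bsub>K\<^esub>"
    unfolding w_def mult res_add one using AB by (simp add: res_def mod_eq_0_iff_dvd mult_2[symmetric])
  have KG: "cay_gens K u v w"
    unfolding cay_gens_def cay_gens_axioms_def using K w2 mem by (simp add: u_def v_def w_def)
  interpret KG: cay_gens K u v w by (rule KG)
  have uv: "u [^]\<^bsub>K\<^esub> i \<otimes>\<^bsub>K\<^esub> v [^]\<^bsub>K\<^esub> j = (res N (i * int L - j * int H), res t j)" for i j :: int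
    unfolding u_def v_def L_def[symmetric] H_def[symmetric] pow mult res_add by simp
  have ptF: "KG.pt i j False = (res N (i * int L - j * int H), res t j)" for i j
    unfolding KG.pt_def uv using KG.r_one[OF mem] by simp
  show ptT: "cay_gens.pt K u v w i j True = \<one>\<^bsub>K\<^esub>"
    if "int N dvd i * int (l div t) - j * int (h div t) + A" "int t dvd j + B" for i j
  proof -
    have "KG.pt i j True = (res N (i * int L - j * int H + A), res t (j + B))"
      unfolding KG.pt_def uv by (simp add: w_def mult res_add)
    then show ?thesis using that by (simp add: res_def one L_def H_def mod_eq_0_iff_dvd)
  qed
  have conn: "{s, inv\<^bsub>G\<^esub> s, s', inv\<^bsub>G\<^esub> s', s0} \<subseteq> carrier G" "{u, inv\<^bsub>K\<^esub> u, v, inv\<^bsub>K\<^esub> v, w} \<subseteq> carrier K"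
    using G.mem KG.mem by auto
  have GG: "comm_group G" by (rule G.comm_group_axioms)
  have finK: "finite (carrier K)" by (simp add: carrier)
  show "cay5 K u v w m l h"
    unfolding cay5_def cay5_axioms_def
  proof (intro conjI allI impI KG finK pos)
    show "card {u, inv\<^bsub>K\<^esub> u, v, inv\<^bsub>K\<^esub> v, w} = 5"
      using Cay_iso_connection_set(1)[OF GG K iso conn] G.card5 by simp
    show "\<one>\<^bsub>K\<^esub> \<notin> {u, inv\<^bsub>K\<^esub> u, v, inv\<^bsub>K\<^esub> v, w}"
      using Cay_iso_connection_set(2)[OF GG K iso conn] G.one_notin by blast
    show "KG.pt i j False = \<one>\<^bsub>K\<^esub> \<longleftrightarrow> int l dvd j \<and> int m dvd i - j div int l * int h" for i j
    proof -
      have "KG.pt i j False = \<one>\<^bsub>K\<^esub> \<longleftrightarrow> int m * int L dvd i * int L - j * int H \<and> int t dvd j"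
        unfolding ptF one res_def N(1) by (simp add: mod_eq_0_iff_dvd)
      then show ?thesis
        using residue_pairs_kernel[of "int t" "int L" "int m" "int H" i j] t(1) L pos(1) cop
        by (simp add: lL hH)
    qed
    fix x assume "x \<in> carrier K"
    then obtain a b where x: "x = (res N a, res t b)"
    proof -
      from \<open>x \<in> carrier K\<close> obtain a b where "x = (a, b)" "a \<in> {0..<int N}" "b \<in> {0..<int t}"
        unfolding carrier by blast
      then have "x = (res N a, res t b)" by (simp add: res_def)
      then show thesis by (rule that)
    qed
    have "coprime (int L) (int h)" using cop by (simp add: hH coprime_commute)
    then obtain \<alpha> \<beta> where bez: "\<alpha> * int L + \<beta> * int h = 1"
      by (metis bezout_int coprime_iff_gcd_eq_1)
    \<comment> \<open>\<open>c\<close> compensates the contribution of \<open>v\<close>; Bezout then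
      solves \<open>i * L - j * H = a\<close> with \<open>j\<close> congruent to \<open>b\<close>
      modulo \<open>t\<close>.\<close>
    define c where "c = a + b * int H"
    have "(c * \<alpha>) * int L - (b - int t * (c * \<beta>)) * int H = c * (\<alpha> * int L + \<beta> * int h) - b * int H"
      by (simp add: hH algebra_simps)
    also have "\<dots> = a" unfolding bez by (simp add: c_def)
    finally have "KG.pt (c * \<alpha>) (b - int t * (c * \<beta>)) False = x"
      unfolding ptF x by (simp add: res_def mod_eq_dvd_iff)
    then show "\<exists>i j b. x = KG.pt i j b" by metis
  qed
  have "card (carrier K) = N * t" by (simp add: carrier card_cartesian_product)
  then show "card (carrier G) = m * l"
    using Cay_iso_card_carrier[OF iso] by (simp add: N(1) lL)
  show "card {C. perfect_code (Cay G {s, inv\<^bsub>G\<^esub> s, s', inv\<^bsub>G\<^esub> s', s0}) C \<and> \<one>\<^bsub>G\<^esub> \<in> C} =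
         card {C. perfect_code (Cay K {u, inv\<^bsub>K\<^esub> u, v, inv\<^bsub>K\<^esub> v, w}) C \<and> \<one>\<^bsub>K\<^esub> \<in> C}"
    by (rule Cay_iso_card_codes[OF GG K iso G.fin finK])
qed

lemma X1_card_carrier:
  assumes "cay5 G s s' s0 m l h"
    and "isoX1 (Cay G S) m l h"
  shows "card (carrier G) = 2 * m * l"
proof -
  interpret G: cay5 G s s' s0 m l h by (rule assms(1))
  define t where "t = tau (int h) (int l)"
  have t: "t > 0" "t dvd l"
    unfolding t_def using tau_props[of "int l" "int h"] G.l_pos by auto
  define N where "N = m * l div t"
  have N: "N * t = m * l" using t(2) by (simp add: N_def)
  then have N0: "N > 0" using G.m_pos G.l_pos by (cases N) auto
  have "card (carrier G) = card (carrier (integer_mod_group N \<times>\<times> (integer_mod_group t \<times>\<times> integer_mod_group 2)))"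
    using assms(2) unfolding isoX1_def X1_def Let_def t_def[symmetric] N_def[symmetric]
    by (elim conjE) (rule Cay_iso_card_carrier)
  also have "\<dots> = N * t * 2" using t(1) N0 by (simp add: carrier_integer_mod_group card_cartesian_product)
  finally show ?thesis using N by simp
qed

text \<open>The involution of this model is \<open>m'\<close> times \<open>u\<close>, so the model
  falls under \<open>kernel_gens_half_m\<close>.\<close>

lemma X2_model:
  fixes G :: "('g, 'b) monoid_scheme"
  assumes G: "cay5 G s s' s0 m l h"
    and iso: "isoX2 (Cay G {s, inv\<^bsub>G\<^esub> s, s', inv\<^bsub>G\<^esub> s', s0}) m l h" and m: "int m = 2 * m'"
  obtains K u v w where "cay5 (K :: (int \<times> int) monoid) u v w m l h" "cay_gens.pt K u v w m' 0 True = \<one>\<^bsub>K\<^esub>"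
    "card (carrier G) = m * l"
    "card {C. perfect_code (Cay G {s, inv\<^bsub>G\<^esub> s, s', inv\<^bsub>G\<^esub> s', s0}) C \<and> \<one>\<^bsub>G\<^esub> \<in> C} =
     card {C. perfect_code (Cay K {u, inv\<^bsub>K\<^esub> u, v, inv\<^bsub>K\<^esub> v, w}) C \<and> \<one>\<^bsub>K\<^esub> \<in> C}"
proof -
  interpret G: cay5 G s s' s0 m l h by (rule G)
  define t where "t = tau (int h) (int l)"
  have t: "t > 0" "t dvd l"
    unfolding t_def using tau_props[of "int l" "int h"] G.l_pos by auto
  then obtain L where L: "l = t * L" by blast
  have N: "int (m * l div t) = 2 * (m' * int L)"
  proof -
    have "m * l div t = m * L" using t(1) by (simp add: L)
    then show ?thesis using m by simp
  qed
  have A: "int (m * l div (2 * t)) = m' * int L"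
  proof -
    have "int (m * l) = 2 * int t * (m' * int L)" by (simp add: L m)
    then show ?thesis using t(1) by (simp add: zdiv_int)
  qed
  note iso = iso[unfolded isoX2_def X2_def Let_def, folded t_def]
  have AB: "int (m * l div t) dvd 2 * int (m * l div (2 * t))" "int t dvd 2 * 0" unfolding N A by simp_all
  note M = model_cay5[OF G, folded t_def, OF iso[THEN conjunct1] AB iso[THEN conjunct2]]
  have "int (m * l div t) dvd m' * int (l div t) - 0 * int (h div t) + int (m * l div (2 * t))" "int t dvd 0 + 0"
    unfolding N A using t(1) by (simp_all add: L)
  from that[OF M(1) M(2)[OF this] M(3,4)] show thesis .
qed

text \<open>The involution of this model is \<open>h' + q\<close> times \<open>u\<close> plus
  \<open>l'\<close> times \<open>v\<close>. Since \<open>h' * L = l' * H\<close>, the relation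
  reduces to \<open>m\<close> dividing \<open>2 * q\<close>.\<close>

lemma X3_model:
  fixes G :: "('g, 'b) monoid_scheme"
  assumes G: "cay5 G s s' s0 m l h"
    and iso: "isoX3 (Cay G {s, inv\<^bsub>G\<^esub> s, s', inv\<^bsub>G\<^esub> s', s0}) m l h"
    and l: "int l = 2 * l'" and h: "int h = 2 * h'" and q: "int m + int (lcm m h) = 2 * q"
  obtains K u v w where "cay5 (K :: (int \<times> int) monoid) u v w m l h" "cay_gens.pt K u v w (h' + q) l' True = \<one>\<^bsub>K\<^esub>"
    "card (carrier G) = m * l"
    "card {C. perfect_code (Cay G {s, inv\<^bsub>G\<^esub> s, s', inv\<^bsub>G\<^esub> s', s0}) C \<and> \<one>\<^bsub>G\<^esub> \<in> C} =
     card {C. perfect_code (Cay K {u, inv\<^bsub>K\<^esub> u, v, inv\<^bsub>K\<^esub> v, w}) C \<and> \<one>\<^bsub>K\<^esub> \<in> C}"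
proof -
  interpret G: cay5 G s s' s0 m l h by (rule G)
  define t where "t = tau (int h) (int l)"
  have t: "t > 0" "t dvd l"
    unfolding t_def using tau_props[of "int l" "int h"] G.l_pos by auto
  then obtain L where L: "l = t * L" by blast
  note iso = iso[unfolded isoX3_def X3_def Let_def, folded t_def]
  then obtain H where H: "h = t * H" by blast
  have N: "int (m * l div t) = int m * int L"
    using t(1) by (simp add: L)
  have A: "int (l * (m + lcm m h) div (2 * t)) = q * int L"
  proof -
    have "int (l * (m + lcm m h)) = 2 * int t * (q * int L)" using q by (simp add: L)
    then show ?thesis using t(1) by (simp add: zdiv_int)
  qed
  have B: "int (l div 2) = l'" using l by simp
  have "int m dvd int m + int (lcm m h)" by simp
  then have mq: "int m dvd 2 * q" unfolding q .
  then have A2: "int m * int L dvd 2 * (q * int L)" by (metis mult.assoc mult_dvd_mono dvd_refl)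
  have AB: "int (m * l div t) dvd 2 * int (l * (m + lcm m h) div (2 * t))" "int t dvd 2 * int (l div 2)"
    unfolding N A B using A2 t(2) by (simp_all add: l[symmetric])
  note M = model_cay5[OF G, folded t_def, OF iso[THEN conjunct1] AB iso[THEN conjunct2]]
  have "int (m * l div t) dvd (h' + q) * int (l div t) - l' * int (h div t) + int (l * (m + lcm m h) div (2 * t))"
    "int t dvd l' + int (l div 2)"
  proof -
    have "h' * int L = l' * int H"
    proof -
      have "2 * int t * (h' * int L) = 2 * int t * (l' * int H)"
      proof -
        have "2 * int t * (h' * int L) = (2 * h') * (int t * int L)" by simp
        also have "\<dots> = (int t * int H) * (2 * l')" using h l by (simp add: H L)
        finally show ?thesis by (simp add: mult.commute)
      qed
      then show ?thesis using t(1) by simp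
    qed
    then have "(h' + q) * int (l div t) - l' * int (h div t) + q * int L = 2 * (q * int L)"
      using t(1) by (simp add: L H algebra_simps)
    then show "int (m * l div t) dvd (h' + q) * int (l div t) - l' * int (h div t) + int (l * (m + lcm m h) div (2 * t))"
      unfolding N A using A2 by simp
    have "l' + l' = int l" using l by simp
    then show "int t dvd l' + int (l div 2)" unfolding B using t(2) by simp
  qed
  from that[OF M(1) M(2)[OF this] M(3,4)] show thesis .
qed

section \<open>From the hypotheses on the group to \<open>cay5\<close>\<close>

lemma (in cay_gens) pt_range_generate:
  assumes "x \<in> generate G {s, inv s, s', inv s', s0}"
  shows "\<exists>i j b. x = pt i j b"
  using assms
proof induction
  case one
  then show ?case using pt_0 by metis
next
  case (incl x)
  then show ?case using pt_gens by (elim insertE emptyE) metis+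
next
  case (inv x)
  have "\<exists>i j b. x = pt i j b" using inv pt_gens by (elim insertE emptyE) metis+
  then show ?case using pt_inv by metis
next
  case (eng x y)
  then show ?case using pt_mult by metis
qed

text \<open>Dividing \<open>j\<close> by \<open>l\<close> splits off copies of the relation
  \<open>(h, l)\<close>. Minimality of \<open>l\<close> kills the remainder in every relation, and
  what is left is governed by the order of \<open>s\<close>.\<close>

lemma cay5I:
  fixes G (structure)
  assumes "comm_group G" and fin: "finite (carrier G)"
    and S: "{s, inv s, s', inv s', s0} \<subseteq> carrier G - {\<one>}"
    and gen: "generate G {s, inv s, s', inv s', s0} = carrier G"
    and card: "card {s, inv s, s', inv s', s0} = 5"
    and ord: "group.ord G s0 = 2"
    and m: "m = group.ord G s"
    and l: "l = (LEAST k::nat. 0 < k \<and> s' [^] k \<in> generate G {s})"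
    and h: "s [^] h \<otimes> s' [^] l = \<one>"
  shows "cay5 G s s' s0 m l h"
proof -
  interpret comm_group G by fact
  have mem: "s \<in> carrier G" "s' \<in> carrier G" "s0 \<in> carrier G" using S by auto
  have "s0 [^] (2 :: nat) = \<one>" using pow_ord_eq_1[OF mem(3)] ord by simp
  then have sq: "s0 \<otimes> s0 = \<one>" using mem by (simp add: numeral_2_eq_2)
  interpret cay_gens G s s' s0 by unfold_locales (fact mem sq)+
  have m_pos: "m > 0" unfolding m using ord_ge_1[OF fin mem(1)] by simp
  have gs: "x \<in> generate G {s} \<longleftrightarrow> (\<exists>k::int. x = s [^] k)" for x
    using generate_pow[OF mem(1)] by auto
  have L: "0 < l \<and> s' [^] l \<in> generate G {s}"
  proof -
    have "0 < ord s' \<and> s' [^] ord s' \<in> generate G {s}"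
      using ord_ge_1[OF fin mem(2)] pow_ord_eq_1[OF mem(2)] generate.one by simp
    then show ?thesis unfolding l by (rule LeastI)
  qed
  have Lmin: "\<not> (0 < k \<and> s' [^] k \<in> generate G {s})" if "k < l" for k
    using not_less_Least[OF that[unfolded l]] .
  have base: "pt (q * int h) (q * int l) False = \<one>" for q
  proof -
    have "x [^] (q * int n) = (x [^] n) [^] q" if "x \<in> carrier G" for x n
      using int_pow_pow[OF that, of "int n" q] by (simp add: int_pow_int mult.commute)
    then have "pt (q * int h) (q * int l) False = (s [^] h) [^] q \<otimes> (s' [^] l) [^] q"
      using mem by (simp add: pt_def)
    also have "\<dots> = (s [^] h \<otimes> s' [^] l) [^] q" using mem by (simp add: int_pow_distrib)
    finally show ?thesis using h by simp
  qed
  have x0: "pt i 0 False = \<one> \<longleftrightarrow> int m dvd i" for i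
    using int_pow_eq_id[OF mem(1)] mem by (simp add: pt_def m)
  have red: "pt i j False = pt (i - q * int h) (j - q * int l) False" for i j q
    using pt_add_kernel[OF base, of "i - q * int h" q "j - q * int l" False] by simp
  have "pt i j False = \<one> \<longleftrightarrow> int l dvd j \<and> int m dvd i - (j div int l) * int h" for i j
  proof -
    let ?q = "j div int l" and ?r = "nat (j mod int l)"
    have r: "j - ?q * int l = int ?r" "?r < l"
      using L by (simp_all add: minus_div_mult_eq_mod nat_less_iff)
    have *: "pt i j False = pt (i - ?q * int h) (int ?r) False" using red[of i j ?q] unfolding r(1) .
    have "?r = 0" if "pt i j False = \<one>"
    proof -
      have "s [^] (i - ?q * int h) \<otimes> s' [^] ?r = \<one>"
        using that mem unfolding * by (simp add: pt_def int_pow_int[symmetric])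
      then have "s' [^] ?r = inv (s [^] (i - ?q * int h))"
        using mem by (metis inv_equality inv_inv int_pow_closed m_comm nat_pow_closed)
      also have "\<dots> = s [^] (- (i - ?q * int h))" using mem by (simp only: int_pow_neg)
      finally have "s' [^] ?r \<in> generate G {s}" unfolding gs by blast
      then show ?thesis using Lmin[OF r(2)] by linarith
    qed
    moreover have "j mod int l \<ge> 0" using L by simp
    then have r0: "?r = 0 \<longleftrightarrow> int l dvd j" unfolding dvd_eq_mod_eq_0 by linarith
    moreover have "pt i j False = \<one> \<longleftrightarrow> int m dvd i - ?q * int h" if "?r = 0"
      using * x0 unfolding that by simp
    ultimately show ?thesis by blast
  qed
  then show ?thesis
    using fin m_pos L card S pt_range_generate unfolding gen by unfold_locales auto
qed

subsection \<open>Counting codes by slope\<close>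

lemma sigma2_eq_enat_iff: "sigma2 n = enat j \<longleftrightarrow> 2 ^ j dvd n \<and> \<not> 2 ^ Suc j dvd n"
  unfolding enat_le_sigma2[symmetric] Suc_ile_eq by (auto simp: antisym_conv1 not_less)

lemma sigma2_le_enat_iff: "sigma2 n \<le> enat j \<longleftrightarrow> \<not> 2 ^ Suc j dvd n"
  unfolding enat_le_sigma2[symmetric] Suc_ile_eq by auto

lemma sigma2_eq_0_iff: "sigma2 n = 0 \<longleftrightarrow> odd n"
  using sigma2_eq_enat_iff[of n 0] by (simp add: zero_enat_def)

lemma sigma2_mult_pow2_odd: "odd c \<Longrightarrow> sigma2 (2 ^ k * c) = enat k"
  unfolding sigma2_eq_enat_iff by (simp add: mult.commute[of 2])

text \<open>This decides between a third and a sixth of the gcd: doubling the second argument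
  doubles the gcd only if \<open>R\<close> contains the new power of 2.\<close>

lemma gcd_double_pow2_odd:
  fixes R c :: int
  assumes "odd c"
  shows "gcd R (2 ^ Suc k * c) =
    (if 2 ^ Suc k dvd R then 2 * gcd R (2 ^ k * c) else gcd R (2 ^ k * c))"
proof (cases "2 ^ Suc k dvd R")
  case True
  then obtain \<rho> where \<rho>: "R = 2 ^ Suc k * \<rho>" by blast
  have "coprime c 2" using assms by simp
  then have "gcd (2 * \<rho>) c = gcd \<rho> c"
    by (metis coprime_commute gcd_mult_left_left_cancel)
  then have "gcd R (2 ^ k * c) = 2 ^ k * gcd \<rho> c"
    using gcd_mult_distrib_int[of "2 ^ k" "2 * \<rho>" c] by (simp add: \<rho> ac_simps)
  moreover have "gcd R (2 ^ Suc k * c) = 2 ^ Suc k * gcd \<rho> c"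
    using gcd_mult_distrib_int[of "2 ^ Suc k" \<rho> c] by (simp add: \<rho>)
  ultimately show ?thesis using True by simp
next
  case False
  let ?M = "2 ^ Suc k * c"
  let ?g = "gcd R ?M"
  have "?M \<noteq> 0" using assms by auto
  then have "even (?M div ?g)"
    using odd_div_gcd_iff[of ?M R] False sigma2_mult_pow2_odd[OF assms, of "Suc k"]
    by (simp add: gcd.commute enat_le_sigma2 del: power_Suc)
  then obtain e where "?M div ?g = 2 * e" by blast
  then have "?M = ?g * (2 * e)" by (metis dvd_mult_div_cancel gcd_dvd2)
  then have "2 * (2 ^ k * c) = 2 * (?g * e)" by simp
  then have "2 ^ k * c = ?g * e" by simp
  then have "?g dvd 2 ^ k * c" by (metis dvd_triv_left)
  then have "?g dvd gcd R (2 ^ k * c)" by simp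
  moreover have "gcd R (2 ^ k * c) dvd ?g" by (simp add: dvd_mult2 mult.assoc)
  ultimately have "?g = gcd R (2 ^ k * c)" by (simp add: zdvd_antisym_nonneg)
  then show ?thesis using False by simp
qed

text \<open>The number of codes of one slope: \<open>b\<close> tells whether the slope is
  admissible, \<open>d\<close> counts diagonals, and the one through the identity has a fixed
  height. Truncated subtraction identifies \<open>d = 0\<close> with \<open>d = 1\<close>, so
  comparisons ask for \<open>d > 0\<close>.\<close>

definition cnt :: "bool \<Rightarrow> int \<Rightarrow> nat" where
  "cnt b d = (if b then 2 ^ (nat d - 1) else 0)"

lemma cnt_pos_iff: "cnt b d > 0 \<longleftrightarrow> b"
  by (simp add: cnt_def)

lemma cnt_True_eq_iff: "d > 0 \<Longrightarrow> d' > 0 \<Longrightarrow> cnt True d = cnt True d' \<longleftrightarrow> d = d'"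
  by (auto simp: cnt_def)

lemma cnt_True_le: "d \<le> d' \<Longrightarrow> cnt True d \<le> cnt True d'"
  by (auto simp: cnt_def intro!: diff_le_mono)

context cay5
begin

text \<open>Bundles the number of codes, which can be compared with a model, with their explicit
  form, which is the conclusion. For false \<open>b\<close> the value of \<open>d\<close> is
  arbitrary.\<close>

definition shape :: "int \<Rightarrow> bool \<Rightarrow> int \<Rightarrow> bool" where
  "shape a b d \<longleftrightarrow> finite (codes a) \<and> card (codes a) = cnt b d \<and> (\<not> b \<longrightarrow> codes a = {}) \<and>
     (b \<longrightarrow> d > 0 \<and> codes a =
        {\<Union>i \<in> {0..d - 1}. Dset G s s' s0 a i (j i) | j :: int \<Rightarrow> int. j 0 = 0 \<and> (\<forall>i. j i \<in> {0, 1})})"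

lemma shape_cong: "shape a b d \<Longrightarrow> b = b' \<Longrightarrow> (b \<Longrightarrow> d = d') \<Longrightarrow> shape a b' d'"
  by (cases b) (auto simp: shape_def cnt_def)

lemma shape_kernel_gens:
  assumes "kernel_gens p w1 q v w2" "p > 0" "a \<in> {-1, 1}"
  shows "shape a (ok p w1 (q - a * v) (odd v \<noteq> w2)) (gcd p (q - a * v) div 3)"
proof (cases "ok p w1 (q - a * v) (odd v \<noteq> w2)")
  case True
  then show ?thesis using codes_ok[OF assms True] by (simp add: shape_def cnt_def)
next
  case False
  then show ?thesis using codes_empty[OF assms False] by (simp add: shape_def cnt_def)
qed

lemma card_shapes:
  assumes "shape (-1) b1 d1" "shape 1 b2 d2"
  shows "card {C. perfect_code \<Gamma> C \<and> \<one> \<in> C} = cnt b1 d1 + cnt b2 d2"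
  using assms codes_disjoint unfolding perfect_codes_eq shape_def by (simp add: card_Un_disjoint)

lemma perfect_codes_shapes:
  assumes "\<And>a. a \<in> {-1, 1} \<Longrightarrow> shape a (a \<in> I) (d a)" and "I \<subseteq> {-1, 1}"
  shows "{C. perfect_code \<Gamma> C \<and> \<one> \<in> C} =
    {\<Union>i \<in> {0..d a - 1}. Dset G s s' s0 a i (j i) | a (j :: int \<Rightarrow> int). a \<in> I \<and> j 0 = 0 \<and> (\<forall>i. j i \<in> {0, 1})}"
proof -
  have sh: "codes a = (if a \<in> I then {\<Union>i \<in> {0..d a - 1}. Dset G s s' s0 a i (j i) | j :: int \<Rightarrow> int.
      j 0 = 0 \<and> (\<forall>i. j i \<in> {0, 1})} else {})" if "a \<in> {-1, 1}" for a
    using assms(1)[OF that] unfolding shape_def by auto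
  have "codes (-1) \<union> codes 1 = (\<Union>a \<in> I. codes a)"
  proof
    have "codes a \<subseteq> (\<Union>a \<in> I. codes a)" if "a \<in> {-1, 1}" for a
    proof (cases "a \<in> I")
      case False
      then show ?thesis using sh[OF that] by simp
    qed blast
    then show "codes (-1) \<union> codes 1 \<subseteq> (\<Union>a \<in> I. codes a)" by simp
  qed (use assms(2) in blast)
  also have "\<dots> = (\<Union>a \<in> I. {\<Union>i \<in> {0..d a - 1}. Dset G s s' s0 a i (j i) | j :: int \<Rightarrow> int.
      j 0 = 0 \<and> (\<forall>i. j i \<in> {0, 1})})"
  proof (intro SUP_cong refl)
    fix a assume a: "a \<in> I"
    then have "a \<in> {-1, 1}" using assms(2) by blast
    from sh[OF this] a show "codes a = {\<Union>i \<in> {0..d a - 1}. Dset G s s' s0 a i (j i) | j :: int \<Rightarrow> int.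
      j 0 = 0 \<and> (\<forall>i. j i \<in> {0, 1})}" by simp
  qed
  also have "\<dots> = {\<Union>i \<in> {0..d a - 1}. Dset G s s' s0 a i (j i) | a (j :: int \<Rightarrow> int).
      a \<in> I \<and> j 0 = 0 \<and> (\<forall>i. j i \<in> {0, 1})}"
    by blast
  finally show ?thesis unfolding perfect_codes_eq .
qed

lemma ex_code_through_one:
  assumes "perfect_code \<Gamma> C"
  shows "{C. perfect_code \<Gamma> C \<and> \<one> \<in> C} \<noteq> {}"
proof -
  have C: "C \<subseteq> carrier G" "tiling (\<lambda>x y z. pt x y z \<in> C)"
    using assms perfect_code_iff_tiling by auto
  have "\<exists>x y z. pt x y z \<in> C" using tiling_dominated[OF C(2)] by blast
  then obtain u v w where uvw: "pt u v w \<in> C" by blast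
  let ?C = "{g \<in> carrier G. g \<otimes> pt u v w \<in> C}"
  have "(\<lambda>x y z. pt x y z \<in> ?C) = (\<lambda>x y z. pt (x + u) (y + v) (z \<noteq> w) \<in> C)"
    by (simp add: pt_mult)
  then have "perfect_code \<Gamma> ?C"
    using perfect_code_iff_tiling tiling_translate[OF C(2), of u v w] by auto
  moreover have "\<one> \<in> ?C" using uvw by simp
  ultimately show ?thesis by blast
qed

text \<open>For \<open>a\<close> equal to 1 or -1, \<open>h - a * l\<close> is
  \<open>- a * (l - a * h)\<close>. The generator \<open>(h, l)\<close> produces the former, the
  theorem speaks of the latter.\<close>

lemma dvd_offset_iff:
  assumes "a \<in> {-1, 1}"
  shows "n dvd int h - a * int l \<longleftrightarrow> n dvd int l - a * int h"
    and "sigma2 (int h - a * int l) = sigma2 (int l - a * int h)"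
    and "gcd p (int h - a * int l) = gcd (int l - a * int h) p"
proof -
  have "int h - a * int l = int l - a * int h \<or> int h - a * int l = - (int l - a * int h)"
    using assms by auto
  moreover have "(n dvd x \<longleftrightarrow> n dvd y) \<and> sigma2 x = sigma2 y \<and> gcd p x = gcd y p"
    if "x = y \<or> x = - y" for x y :: int
    using that by (auto simp: sigma2_def gcd.commute)
  ultimately show "n dvd int h - a * int l \<longleftrightarrow> n dvd int l - a * int h"
    and "sigma2 (int h - a * int l) = sigma2 (int l - a * int h)"
    and "gcd p (int h - a * int l) = gcd (int l - a * int h) p"
    by blast+
qed

text \<open>The shift along \<open>m\<close> keeps parities; the one along \<open>(h, l)\<close>
  negates them iff \<open>l\<close> is odd. In that case consistency needs fewer factors 2 in
  \<open>l - a * h\<close> than in \<open>m\<close>.\<close>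

lemma shape_direct:
  assumes a: "a \<in> {-1, 1}" and m: "3 dvd m" "int m = 2 ^ Suc k * c" "odd c"
    and k: "\<And>x y. pt x y True \<noteq> \<one>"
  shows "shape a (3 dvd int l - a * int h \<and> (odd l \<longrightarrow> \<not> 2 ^ Suc k dvd int l - a * int h))
     (gcd (int l - a * int h) (int m) div 3)"
proof (rule shape_cong[OF shape_kernel_gens[OF kernel_gens_direct[OF k] _ a]])
  have sm: "sigma2 (int m) = enat (Suc k)" unfolding m(2) by (rule sigma2_mult_pow2_odd[OF m(3)])
  have "(3::int) dvd int m" using m(1) by presburger
  then show "ok (int m) False (int h - a * int l) (odd (int l) \<noteq> False) =
    (3 dvd int l - a * int h \<and> (odd l \<longrightarrow> \<not> 2 ^ Suc k dvd int l - a * int h))"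
    unfolding ok_def dvd_offset_iff[OF a] sm enat_le_sigma2
    using linear[of "sigma2 (int l - a * int h)" "enat (Suc k)"] unfolding enat_le_sigma2 by auto
qed (use m_pos dvd_offset_iff[OF a] in simp_all)

text \<open>The shift along \<open>m'\<close> passes through \<open>s0\<close> and negates parities.
  So the power of 2 in \<open>m'\<close> must divide \<open>l - a * h\<close>, and the next power
  divides it iff the shift along \<open>(h, l)\<close> keeps parities.\<close>

lemma shape_half_m:
  assumes a: "a \<in> {-1, 1}" and m: "3 dvd m" "int m = 2 ^ Suc k * c" "odd c"
    and k: "pt m' 0 True = \<one>" "int m = 2 * m'"
  shows "shape a (3 dvd int l - a * int h \<and> 2 ^ k dvd int l - a * int h \<and>
        (odd l \<longleftrightarrow> \<not> 2 ^ Suc k dvd int l - a * int h))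
     (if 2 ^ Suc k dvd int l - a * int h then gcd (int l - a * int h) (int m) div 6
      else gcd (int l - a * int h) (int m) div 3)"
proof (rule shape_cong[OF shape_kernel_gens[OF kernel_gens_half_m[OF k(2,1)] _ a]])
  have m': "m' = 2 ^ k * c" using k(2) m(2) by simp
  have sm: "sigma2 m' = enat k" unfolding m' by (rule sigma2_mult_pow2_odd[OF m(3)])
  show "0 < m'" using k(2) m_pos by simp
  have "3 dvd m'" using m(1) k(2) by presburger
  then show "ok m' True (int h - a * int l) (odd (int l) \<noteq> False) =
    (3 dvd int l - a * int h \<and> 2 ^ k dvd int l - a * int h \<and>
        (odd l \<longleftrightarrow> \<not> 2 ^ Suc k dvd int l - a * int h))"
    unfolding ok_def dvd_offset_iff[OF a] sm enat_le_sigma2 sigma2_le_enat_iff by auto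
  have g: "gcd (int l - a * int h) (int m) =
      (if 2 ^ Suc k dvd int l - a * int h then 2 * gcd (int l - a * int h) m' else gcd (int l - a * int h) m')"
    unfolding m(2) m' by (rule gcd_double_pow2_odd[OF m(3)])
  show "gcd m' (int h - a * int l) div 3 = (if 2 ^ Suc k dvd int l - a * int h
      then gcd (int l - a * int h) (int m) div 6 else gcd (int l - a * int h) (int m) div 3)"
    unfolding dvd_offset_iff[OF a] g using div_mult_mult1[of 2 "gcd (int l - a * int h) m'" 3] by simp
qed

text \<open>Modulo \<open>m\<close>, \<open>2 * (x0 - a * l')\<close> equals
  \<open>h - a * l\<close>. As 2 is invertible modulo 3, divisibility by 3 agrees; the gcds with
  \<open>m\<close> agree or differ by a factor 2. Because of \<open>s0\<close>, parities are negated
  iff \<open>l'\<close> is even.\<close>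

lemma shape_half_l:
  assumes a: "a \<in> {-1, 1}" and m: "3 dvd m" "int m = 2 ^ Suc k * c" "odd c"
    and k: "pt x0 l' True = \<one>" "int l = 2 * l'"
  shows "shape a (3 dvd int l - a * int h \<and> (even l' \<longrightarrow> \<not> 2 ^ Suc k dvd x0 - a * l'))
     (if 2 ^ Suc k dvd x0 - a * l' then gcd (int l - a * int h) (int m) div 3
      else gcd (int l - a * int h) (int m) div 6)" (is "shape a ?b ?d")
    and "2 ^ Suc k dvd x0 - a * l' \<Longrightarrow> 2 ^ Suc k dvd int l - a * int h"
proof -
  let ?r = "x0 - a * l'" and ?R = "int h - a * int l"
  obtain e where e: "2 * x0 - int h = int m * e"
    using kernel_gens_half_l(2)[OF k(2,1)] by blast
  have r: "2 * ?r = ?R + e * int m" using e k(2) by (simp add: algebra_simps)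
  show "2 ^ Suc k dvd int l - a * int h" if "2 ^ Suc k dvd ?r"
  proof -
    have "2 ^ Suc k dvd e * int m" unfolding m(2) by (intro dvd_mult dvd_triv_left)
    then have "2 ^ Suc k dvd 2 * ?r - e * int m" by (rule dvd_diff[OF dvd_mult[OF that]])
    then show ?thesis unfolding r dvd_offset_iff(1)[OF a, symmetric] by simp
  qed
  have 3: "(3::int) dvd int m" using m(1) by presburger
  have d3: "3 dvd ?r \<longleftrightarrow> 3 dvd ?R"
  proof -
    have "3 dvd ?r \<longleftrightarrow> 3 dvd 2 * ?r" by presburger
    also have "\<dots> \<longleftrightarrow> 3 dvd ?R" unfolding r using 3 by (simp add: dvd_add_left_iff)
    finally show ?thesis .
  qed
  have sm: "sigma2 (int m) = enat (Suc k)" unfolding m(2) by (rule sigma2_mult_pow2_odd[OF m(3)])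
  have "gcd ?R (int m) = gcd (2 * ?r) (int m)"
    unfolding r by (metis add.commute gcd.commute gcd_add_mult)
  also have "\<dots> = 2 * gcd ?r (2 ^ k * c)"
    using gcd_mult_distrib_int[of 2 ?r "2 ^ k * c"] by (simp add: m(2) mult.assoc)
  finally have g: "gcd ?R (int m) = (if 2 ^ Suc k dvd ?r then gcd ?r (int m) else 2 * gcd ?r (int m))"
    using gcd_double_pow2_odd[OF m(3), of ?r k] unfolding m(2) by simp
  show "shape a ?b ?d"
  proof (rule shape_cong[OF shape_kernel_gens[OF kernel_gens_half_l(1)[OF k(2,1)] _ a]])
    show "ok (int m) False ?r (odd l' \<noteq> True) = ?b"
      unfolding ok_def sm enat_le_sigma2 d3 dvd_offset_iff(1)[OF a] using 3
        linear[of "sigma2 ?r" "enat (Suc k)"] unfolding enat_le_sigma2 by auto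
    show "gcd (int m) ?r div 3 = ?d"
      using g div_mult_mult1[of 2 "gcd ?r (int m)" 3]
      unfolding dvd_offset_iff(3)[OF a, of "int m", unfolded gcd.commute[of "int m"]]
      by (simp add: gcd.commute)
  qed (use m_pos in simp)
qed

end

subsection \<open>The cases of the theorem\<close>

lemma X23_card_carrier:
  assumes "cay5 G s s' s0 m l h"
    and "isoX2 (Cay G S) m l h \<or> isoX3 (Cay G S) m l h"
  shows "card (carrier G) = m * l"
proof -
  interpret G: cay5 G s s' s0 m l h by (rule assms(1))
  define t where "t = tau (int h) (int l)"
  have t: "t > 0" "t dvd l"
    unfolding t_def using tau_props[of "int l" "int h"] G.l_pos by auto
  define N where "N = m * l div t"
  have N: "N * t = m * l" using t(2) by (simp add: N_def)
  then have N0: "N > 0" using G.m_pos G.l_pos by (cases N) auto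
  have "card (carrier G) = card (carrier (integer_mod_group N \<times>\<times> integer_mod_group t))"
    using assms(2) unfolding isoX2_def X2_def isoX3_def X3_def Let_def t_def[symmetric] N_def[symmetric]
    by (elim disjE conjE) (erule Cay_iso_card_carrier)+
  also have "\<dots> = N * t" using t(1) N0 by (simp add: carrier_integer_mod_group card_cartesian_product)
  finally show ?thesis using N by simp
qed

lemma int_even_decompose:
  fixes n :: int
  assumes "n \<noteq> 0" "even n"
  obtains k c where "n = 2 ^ Suc k * c" "odd c"
proof -
  obtain c where c: "n = 2 ^ multiplicity 2 n * c" "odd c"
    using multiplicity_decompose'[of n 2] assms(1) by (auto simp: mult.commute)
  then obtain k where "multiplicity 2 n = Suc k" using assms(2) by (cases "multiplicity 2 n") auto
  with c that show thesis by metis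
qed

lemma sigma2_mult_neq_0_iff: "sigma2 x * sigma2 y \<noteq> 0 \<longleftrightarrow> even x \<and> even y"
  by (simp add: sigma2_eq_0_iff)

lemma enat_Suc_eq_plus_1_iff: "enat (Suc k) = x + 1 \<longleftrightarrow> x = enat k"
  by (cases x) (auto simp: one_enat_def)

text \<open>\<open>Suc k\<close> is the value of \<open>sigma2 m\<close>, so the 2-adic clauses
  become divisibility by fixed powers of 2.\<close>

lemma cond_A_iff:
  assumes "int m = 2 ^ Suc k * c" "odd c" "6 dvd m"
  shows "cond_A \<Gamma> m l h a \<longleftrightarrow> 3 dvd int l - a * int h \<and>
    ((isoX1 \<Gamma> m l h \<and> (even h \<and> even l \<or> \<not> 2 ^ Suc k dvd int l - a * int h)) \<or>
     (isoX2 \<Gamma> m l h \<and> odd l \<and> 2 ^ k dvd int l - a * int h \<and> \<not> 2 ^ Suc k dvd int l - a * int h) \<or>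
     (isoX3 \<Gamma> m l h \<and> even h \<and> k = 0 \<and> even l \<and> \<not> 4 dvd int l))"
proof -
  have sm: "sigma2 (int m) = enat (Suc k)" unfolding assms(1) by (rule sigma2_mult_pow2_odd[OF assms(2)])
  have s1: "sigma2 (int l) = 1 \<longleftrightarrow> even l \<and> \<not> 4 dvd int l"
    using sigma2_eq_enat_iff[of "int l" 1] by (simp add: one_enat_def)
  have s2: "(enat (Suc k) \<le> sigma2 (int h) \<and> enat (Suc k) = sigma2 (int l) \<and> sigma2 (int l) = 1) \<longleftrightarrow>
      even h \<and> k = 0 \<and> even l \<and> \<not> 4 dvd int l"
    unfolding enat_le_sigma2 s1[symmetric] by (auto simp: one_enat_def)
  have s3: "sigma2 (int l - a * int h) < enat (Suc k) \<longleftrightarrow> \<not> 2 ^ Suc k dvd int l - a * int h"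
    unfolding enat_le_sigma2[symmetric] by auto
  show ?thesis
    unfolding cond_A_def sm s2 s3 enat_Suc_eq_plus_1_iff sigma2_eq_enat_iff sigma2_eq_0_iff sigma2_mult_neq_0_iff
    using assms(3) by simp
qed

lemma cond_B_iff:
  assumes "int m = 2 ^ Suc k * c" "odd c" "6 dvd m"
  shows "cond_B \<Gamma> m l h a \<longleftrightarrow> 3 dvd int l - a * int h \<and>
    ((isoX2 \<Gamma> m l h \<and> even h \<and> even l \<and> 2 ^ Suc k dvd int l - a * int h) \<or>
     (isoX3 \<Gamma> m l h \<and> 2 ^ Suc k dvd int h \<and> \<not> 2 ^ Suc k dvd int l \<and> even l))"
proof -
  have sm: "sigma2 (int m) = enat (Suc k)" unfolding assms(1) by (rule sigma2_mult_pow2_odd[OF assms(2)])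
  have s1: "1 \<le> sigma2 (int l) \<longleftrightarrow> even l"
    using enat_le_sigma2[of 1 "int l"] by (simp add: one_enat_def)
  have s3: "sigma2 (int l) < enat (Suc k) \<longleftrightarrow> \<not> 2 ^ Suc k dvd int l"
    unfolding enat_le_sigma2[symmetric] by auto
  show ?thesis
    unfolding cond_B_def sm s1 s3 enat_le_sigma2 sigma2_mult_neq_0_iff
    using assms(3) by auto
qed

section \<open>The disjuncts of \<open>cond_A\<close> and \<open>cond_B\<close> one by one\<close>

context cay5
begin

abbreviation off :: "int \<Rightarrow> int" where "off a \<equiv> int l - a * int h"

definition code_family :: "int set \<Rightarrow> (int \<Rightarrow> int) \<Rightarrow> 'g set set" where
  "code_family I d = {\<Union>i \<in> {0..d a - 1}. Dset G s s' s0 a i (j i) | a (j :: int \<Rightarrow> int).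
     a \<in> I \<and> j 0 = 0 \<and> (\<forall>i. j i \<in> {0, 1})}"

lemma shape_pos: "shape a b d \<Longrightarrow> b \<Longrightarrow> d > 0"
  by (simp add: shape_def)

lemma perfect_codes_family:
  assumes "\<And>a. a \<in> {-1, 1} \<Longrightarrow> shape a (a \<in> I) (d a)" and "I \<subseteq> {-1, 1}"
  shows "{C. perfect_code \<Gamma> C \<and> \<one> \<in> C} = code_family I d"
  unfolding code_family_def by (rule perfect_codes_shapes[OF assms])

lemma isoX1_direct:
  assumes "isoX1 \<Gamma> m l h"
  shows "pt x y True \<noteq> \<one>" "\<not> isoX2 \<Gamma> m l h" "\<not> isoX3 \<Gamma> m l h"
proof -
  have c: "card (carrier G) = 2 * m * l" by (rule X1_card_carrier[OF cay5_axioms assms])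
  have "m * l > 0" using m_pos l_pos by simp
  then have ne: "card (carrier G) \<noteq> m * l" unfolding c by simp
  show "pt x y True \<noteq> \<one>" using card_carrier_not_direct[of x y] ne by blast
  show "\<not> isoX2 \<Gamma> m l h" "\<not> isoX3 \<Gamma> m l h" using X23_card_carrier[OF cay5_axioms] ne by blast+
qed

lemma isoX23_not_direct:
  assumes "isoX2 \<Gamma> m l h \<or> isoX3 \<Gamma> m l h"
  shows "\<exists>x y. pt x y True = \<one>"
proof (rule ccontr)
  assume "\<nexists>x y. pt x y True = \<one>"
  then have "card (carrier G) = 2 * m * l" using card_carrier_direct by blast
  moreover have "m * l > 0" using m_pos l_pos by simp
  ultimately show False using X23_card_carrier[OF cay5_axioms assms] by simp
qed

lemma gcd_off_pos: "gcd (off a) (int m) > 0"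
  using m_pos by simp

lemma gcd_off_6:
  assumes "3 dvd off a" "even (off a)" "6 dvd m"
  obtains d where "gcd (off a) (int m) = 6 * d" "d > 0"
proof -
  have "(6 :: int) dvd off a" using assms(1,2) by presburger
  moreover have "(6 :: int) dvd int m" using assms(3) by presburger
  ultimately have "6 dvd gcd (off a) (int m)" by simp
  then obtain d where "gcd (off a) (int m) = 6 * d" by blast
  moreover from this have "d > 0" using gcd_off_pos[of a] by simp
  ultimately show thesis by (rule that)
qed

lemma codes_A1:
  assumes m: "6 dvd m" and iso: "isoX1 \<Gamma> m l h"
  shows "{C. perfect_code \<Gamma> C \<and> \<one> \<in> C} =
    code_family {a \<in> {-1, 1}. cond_A \<Gamma> m l h a} (\<lambda>a. gcd (off a) (int m) div 3)"
proof (rule perfect_codes_family)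
  have "even (int m)" using m by presburger
  then obtain k c where kc: "int m = 2 ^ Suc k * c" "odd c"
    using int_even_decompose[of "int m"] m_pos by auto
  have m3: "3 dvd m" using m by presburger
  fix a :: int assume a: "a \<in> {-1, 1}"
  show "shape a (a \<in> {a \<in> {-1, 1}. cond_A \<Gamma> m l h a}) (gcd (off a) (int m) div 3)"
  proof (rule shape_cong[OF shape_direct[OF a m3 kc isoX1_direct(1)[OF iso]]])
    \<comment> \<open>For even \<open>l\<close> and odd \<open>h\<close> the offset is odd, so the
      second alternative in \<open>cond_A\<close> holds automatically; this matches a condition that
      concerns odd \<open>l\<close> only.\<close>
    have "even l \<Longrightarrow> odd h \<Longrightarrow> \<not> 2 ^ Suc k dvd off a"
    proof
      assume "even l" "odd h" "2 ^ Suc k dvd off a"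
      then have "even (off a)" by (metis dvd_power dvd_trans zero_less_Suc)
      then show False using \<open>even l\<close> \<open>odd h\<close> a by auto
    qed
    then show "(3 dvd off a \<and> (odd l \<longrightarrow> \<not> 2 ^ Suc k dvd off a)) = (a \<in> {a \<in> {-1, 1}. cond_A \<Gamma> m l h a})"
      unfolding mem_Collect_eq cond_A_iff[OF kc m] using iso isoX1_direct(2,3)[OF iso] a by blast
  qed simp
qed blast

lemma codes_A2:
  assumes m: "6 dvd m" and iso: "isoX2 \<Gamma> m l h" and l: "odd l"
  shows "{C. perfect_code \<Gamma> C \<and> \<one> \<in> C} =
    code_family {a \<in> {-1, 1}. cond_A \<Gamma> m l h a} (\<lambda>a. gcd (off a) (int m) div 3)"
proof (rule perfect_codes_family)
  have "even (int m)" using m by presburger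
  then obtain k c where kc: "int m = 2 ^ Suc k * c" "odd c"
    using int_even_decompose[of "int m"] m_pos by auto
  have m3: "3 dvd m" using m by presburger
  obtain x y where xy: "pt x y True = \<one>" using isoX23_not_direct iso by blast
  obtain m' where m': "pt m' 0 True = \<one>" "int m = 2 * m'"
  \<comment> \<open>An odd \<open>l\<close> cannot be halved, so \<open>s0\<close> is a multiple of
    \<open>s\<close> as in the model and counts need not be compared.\<close>
  proof (rule s0_location[OF xy])
    fix x0 l' assume "int l = 2 * l'"
    then have "even (int l)" by simp
    with l show thesis by simp
  qed
  fix a :: int assume a: "a \<in> {-1, 1}"
  show "shape a (a \<in> {a \<in> {-1, 1}. cond_A \<Gamma> m l h a}) (gcd (off a) (int m) div 3)"
  proof (rule shape_cong[OF shape_half_m[OF a m3 kc m']])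
    show "(3 dvd off a \<and> 2 ^ k dvd off a \<and> (odd l \<longleftrightarrow> \<not> 2 ^ Suc k dvd off a)) =
        (a \<in> {a \<in> {-1, 1}. cond_A \<Gamma> m l h a})"
      unfolding mem_Collect_eq cond_A_iff[OF kc m] using iso isoX1_direct(2) a l by blast
  qed (use l in auto)
qed blast

text \<open>Wherever \<open>s0\<close> lies, the admissible slopes are those with 3 dividing
  \<open>off a\<close>; only a third or a sixth of the gcd is in doubt. The model attains the larger
  value for both slopes, so equal totals force it in the given group.\<close>

lemma codes_A3:
  assumes m: "6 dvd m" and iso: "isoX3 \<Gamma> m l h" and h: "even h" and l: "even l" "\<not> 4 dvd int l"
    and kc: "int m = 2 * c" "odd c"
  shows "{C. perfect_code \<Gamma> C \<and> \<one> \<in> C} =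
    code_family {a \<in> {-1, 1}. cond_A \<Gamma> m l h a} (\<lambda>a. gcd (off a) (int m) div 3)"
proof (rule perfect_codes_family)
  have kc': "int m = 2 ^ Suc 0 * c" using kc by simp
  have m3: "3 dvd m" using m by presburger
  let ?g = "\<lambda>a. gcd (off a) (int m)"
  have ev: "2 ^ Suc 0 dvd off a" for a using h l by simp
  obtain l' where l': "int l = 2 * l'" "odd l'"
  proof -
    have "\<exists>l'. int l = 2 * l'" using l by presburger
    then obtain l' where "int l = 2 * l'" by blast
    moreover from this l(2) have "odd l'" by auto
    ultimately show thesis by (rule that)
  qed
  obtain h' where h': "int h = 2 * h'" using h by (metis dvdE even_of_nat)
  define q where "q = c + lcm c h'"
  have q: "int m + int (lcm m h) = 2 * q"
  proof -
    have "int (lcm m h) = lcm (2 * c) (2 * h')" by (simp add: lcm_int_int_eq[symmetric] kc h')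
    also have "\<dots> = 2 * lcm c h'" by (simp add: lcm_mult_left)
    finally show ?thesis by (simp add: q_def kc)
  qed
  \<comment> \<open>Since \<open>c\<close> is odd, \<open>lcm c h'\<close> has the parity of
    \<open>h'\<close> and \<open>q\<close> the opposite one.\<close>
  have "even (lcm c h') \<longleftrightarrow> even h'"
  proof
    assume "even (lcm c h')"
    then have "even (c * h')" using lcm_least[of c "c * h'" h'] by (metis dvd_trans dvd_triv_left dvd_triv_right)
    then show "even h'" using kc(2) by simp
  qed (metis dvd_lcm2 dvd_trans)
  then have x_odd: "odd (h' + q)" using kc(2) by (simp add: q_def)
  \<comment> \<open>Oddness of \<open>h' + q\<close> gives the model the largest possible number of codes for each slope.\<close>
  obtain K u v w where K: "cay5 (K :: (int \<times> int) monoid) u v w m l h"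
    and ptK: "cay_gens.pt K u v w (h' + q) l' True = \<one>\<^bsub>K\<^esub>"
    and card: "card {C. perfect_code \<Gamma> C \<and> \<one> \<in> C} =
     card {C. perfect_code (Cay K {u, inv\<^bsub>K\<^esub> u, v, inv\<^bsub>K\<^esub> v, w}) C \<and> \<one>\<^bsub>K\<^esub> \<in> C}"
    by (rule X3_model[OF cay5_axioms iso l'(1) h' q])
  interpret K: cay5 K u v w m l h by (rule K)
  have shK: "K.shape a (3 dvd off a) (?g a div 3)" if a: "a \<in> {-1, 1}" for a
  proof (rule K.shape_cong[OF K.shape_half_l(1)[OF a m3 kc' kc(2) ptK l'(1)]])
    have "2 ^ Suc 0 dvd h' + q - a * l'" using x_odd l'(2) a by auto
    then show "(if 2 ^ Suc 0 dvd h' + q - a * l' then ?g a div 3 else ?g a div 6) = ?g a div 3" by simp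
  qed (use l' in simp)
  have "\<exists>d. \<forall>a \<in> {-1, 1}. shape a (3 dvd off a) (d a) \<and> (d a = ?g a div 3 \<or> d a = ?g a div 6)"
  proof -
    obtain x y where xy: "pt x y True = \<one>" using isoX23_not_direct iso by blast
    show ?thesis
    proof (rule s0_location[OF xy])
      fix m' assume m': "int m = 2 * m'" "pt m' 0 True = \<one>"
      show ?thesis
      proof (intro exI[of _ "\<lambda>a. ?g a div 6"] ballI conjI)
        fix a :: int assume a: "a \<in> {-1, 1}"
        show "shape a (3 dvd off a) (?g a div 6)"
          by (rule shape_cong[OF shape_half_m[OF a m3 kc' kc(2) m'(2,1)]]) (use ev[of a] l in auto)
      qed simp
    next
      fix x0 l'' assume x0: "int l = 2 * l''" "pt x0 l'' True = \<one>"
      then have "l'' = l'" using l' by simp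
      show ?thesis
      proof (intro exI[of _ "\<lambda>a. if 2 ^ Suc 0 dvd x0 - a * l'' then ?g a div 3 else ?g a div 6"] ballI conjI)
        fix a :: int assume a: "a \<in> {-1, 1}"
        show "shape a (3 dvd off a) (if 2 ^ Suc 0 dvd x0 - a * l'' then ?g a div 3 else ?g a div 6)"
          by (rule shape_cong[OF shape_half_l(1)[OF a m3 kc' kc(2) x0(2,1)]])
            (use \<open>l'' = l'\<close> l' in auto)
      qed auto
    qed
  qed
  then obtain d where sh: "\<And>a. a \<in> {-1, 1} \<Longrightarrow> shape a (3 dvd off a) (d a)"
    and d: "\<And>a. a \<in> {-1, 1} \<Longrightarrow> d a = ?g a div 3 \<or> d a = ?g a div 6" by blast
  have le: "d a \<le> ?g a div 3" if a: "a \<in> {-1, 1}" for a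
  proof -
    have "x div 6 \<le> x div 3" if "x > 0" for x :: int using that by presburger
    then have "?g a div 6 \<le> ?g a div 3" using gcd_off_pos by blast
    then show ?thesis using d[OF a] by (metis order_refl)
  qed
  have sum: "cnt (3 dvd off (-1)) (d (-1)) + cnt (3 dvd off 1) (d 1) =
        cnt (3 dvd off (-1)) (?g (-1) div 3) + cnt (3 dvd off 1) (?g 1 div 3)"
    using card_shapes[OF sh sh] K.card_shapes[OF shK shK] card by simp
  have cnt_le: "cnt (3 dvd off a) (d a) \<le> cnt (3 dvd off a) (?g a div 3)" if "a \<in> {-1, 1}" for a
    using cnt_True_le[OF le[OF that]] by (cases "3 dvd off a") (simp_all add: cnt_def)
  have "cnt (3 dvd off (-1)) (d (-1)) = cnt (3 dvd off (-1)) (?g (-1) div 3)"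
    "cnt (3 dvd off 1) (d 1) = cnt (3 dvd off 1) (?g 1 div 3)"
    using sum cnt_le[OF insertI1] cnt_le[OF insertI2[OF singletonI]] by linarith+
  then have eq: "cnt (3 dvd off a) (d a) = cnt (3 dvd off a) (?g a div 3)" if "a \<in> {-1, 1}" for a
    using that by blast
  fix a :: int assume a: "a \<in> {-1, 1}"
  show "shape a (a \<in> {a \<in> {-1, 1}. cond_A \<Gamma> m l h a}) (?g a div 3)"
  proof (rule shape_cong[OF sh[OF a]])
    show "(3 dvd off a) = (a \<in> {a \<in> {-1, 1}. cond_A \<Gamma> m l h a})"
      unfolding mem_Collect_eq cond_A_iff[OF kc' kc(2) m] using iso isoX1_direct(3) a l h by auto
    assume b: "3 dvd off a"
    have "d a > 0" "?g a div 3 > 0"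
      by (rule shape_pos[OF sh[OF a] b], rule K.shape_pos[OF shK[OF a] b])
    with eq[OF a] b show "d a = ?g a div 3" using cnt_True_eq_iff by simp
  qed
qed blast

text \<open>The model has its involution at \<open>m'\<close>, the given group possibly at half of
  \<open>l\<close>. For odd \<open>l'\<close> the group has at least as many codes of each slope as
  the model; for even \<open>l'\<close> at most as many, unless some offset is divisible by 3 but
  not by \<open>2 ^ Suc k\<close>, which is refuted.\<close>

lemma codes_B2:
  assumes m: "6 dvd m" and iso: "isoX2 \<Gamma> m l h" and hl: "even h" "even l"
    and kc: "int m = 2 ^ Suc k * c" "odd c"
    and a0: "a0 \<in> {-1, 1}" "3 dvd off a0" "2 ^ Suc k dvd off a0"
  shows "{C. perfect_code \<Gamma> C \<and> \<one> \<in> C} =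
    code_family {a \<in> {-1, 1}. cond_B \<Gamma> m l h a} (\<lambda>a. gcd (off a) (int m) div 6)"
proof (rule perfect_codes_family)
  have m3: "3 dvd m" using m by presburger
  let ?g = "\<lambda>a. gcd (off a) (int m)"
  let ?b = "\<lambda>a. 3 dvd off a \<and> 2 ^ Suc k dvd off a"
  have ev: "even (off a)" for a using hl by simp
  have B: "a \<in> {a \<in> {-1, 1}. cond_B \<Gamma> m l h a} \<longleftrightarrow> ?b a" if a: "a \<in> {-1, 1}" for a
  proof -
    \<comment> \<open>This disables the \<open>isoX3\<close> clause of \<open>cond_B\<close>, in
      case the graph is isomorphic to both models.\<close>
    have "\<not> (2 ^ Suc k dvd int h \<and> \<not> 2 ^ Suc k dvd int l)"
    proof
      assume A: "2 ^ Suc k dvd int h \<and> \<not> 2 ^ Suc k dvd int l"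
      then have "2 ^ Suc k dvd off a0 + a0 * int h" using a0(3) by (intro dvd_add dvd_mult) blast+
      then show False using A by simp
    qed
    then show ?thesis
      unfolding mem_Collect_eq cond_B_iff[OF kc m] using iso hl a by blast
  qed
  have half_m: "cay5.shape K u v w a (?b a) (?g a div 6)"
    if K: "cay5 K u v w m l h" and m': "int m = 2 * m'" "cay_gens.pt K u v w m' 0 True = \<one>\<^bsub>K\<^esub>"
      and a: "a \<in> {-1, 1}" for K :: "('k, 'c) monoid_scheme" and u v w m' a
  proof -
    interpret K: cay5 K u v w m l h by (rule K)
    have "2 ^ k dvd off a" if "2 ^ Suc k dvd off a" using that by (rule power_le_dvd) simp
    then show ?thesis
      by (intro K.shape_cong[OF K.shape_half_m[OF a m3 kc m'(2,1)]]) (use hl in auto)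
  qed
  have "\<forall>a \<in> {-1, 1}. shape a (?b a) (?g a div 6)"
  proof -
    obtain x y where xy: "pt x y True = \<one>" using isoX23_not_direct iso by blast
    show ?thesis
    proof (rule s0_location[OF xy])
      fix m' assume "int m = 2 * m'" "pt m' 0 True = \<one>"
      then show ?thesis using half_m[OF cay5_axioms] by blast
    next
      fix x0 l' assume x0: "int l = 2 * l'" "pt x0 l' True = \<one>"
      have "even (int m)" using m by presburger
      then obtain m' where m': "int m = 2 * m'" by blast
      obtain K u v w where K: "cay5 (K :: (int \<times> int) monoid) u v w m l h"
        and ptK: "cay_gens.pt K u v w m' 0 True = \<one>\<^bsub>K\<^esub>"
        and card: "card {C. perfect_code \<Gamma> C \<and> \<one> \<in> C} =
         card {C. perfect_code (Cay K {u, inv\<^bsub>K\<^esub> u, v, inv\<^bsub>K\<^esub> v, w}) C \<and> \<one>\<^bsub>K\<^esub> \<in> C}"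
        by (rule X2_model[OF cay5_axioms iso m'])
      interpret K: cay5 K u v w m l h by (rule K)
      define r where "r a = (2 ^ Suc k dvd x0 - a * l')" for a
      define d where "d a = (if r a then ?g a div 3 else ?g a div 6)" for a
      define b where "b a \<longleftrightarrow> 3 dvd off a \<and> (even l' \<longrightarrow> \<not> r a)" for a
      have sh: "shape a (b a) (d a)" if "a \<in> {-1, 1}" for a
        unfolding b_def d_def r_def by (rule shape_half_l(1)[OF that m3 kc x0(2,1)])
      have r: "2 ^ Suc k dvd off a" if "a \<in> {-1, 1}" "r a" for a
        using shape_half_l(2)[OF that(1) m3 kc x0(2,1)] that(2) unfolding r_def .
      have shK: "K.shape a (?b a) (?g a div 6)" if "a \<in> {-1, 1}" for a
        by (rule half_m[OF K m' ptK that])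
      have sum: "cnt (b (-1)) (d (-1)) + cnt (b 1) (d 1) =
          cnt (?b (-1)) (?g (-1) div 6) + cnt (?b 1) (?g 1 div 6)"
        using card_shapes[OF sh sh] K.card_shapes[OF shK shK] card by simp
      have g6: "?g a div 6 > 0 \<and> ?g a div 3 = 2 * (?g a div 6) \<and> ?g a = 6 * (?g a div 6)"
        if "3 dvd off a" for a
        by (rule gcd_off_6[OF that ev m]) auto
      have termwise: ?thesis
        if eq: "\<And>a. a \<in> {-1, 1} \<Longrightarrow> cnt (b a) (d a) = cnt (?b a) (?g a div 6)"
      proof
        fix a :: int assume a: "a \<in> {-1, 1}"
        show "shape a (?b a) (?g a div 6)"
        proof (rule shape_cong[OF sh[OF a]])
          show bb: "b a = ?b a" using eq[OF a] cnt_pos_iff by metis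
          assume "b a"
          then have "cnt True (d a) = cnt True (?g a div 6)" "3 dvd off a" using eq[OF a] bb by simp_all
          moreover have "d a > 0" using g6[OF \<open>3 dvd off a\<close>] by (auto simp: d_def)
          ultimately show "d a = ?g a div 6" using cnt_True_eq_iff g6 by blast
        qed
      qed
      show ?thesis
      proof (cases "odd l'")
        case True
        have le: "cnt (?b a) (?g a div 6) \<le> cnt (b a) (d a)" if a: "a \<in> {-1, 1}" for a
        proof (cases "?b a")
          case b: True
          then have "b a" using True by (simp add: b_def)
          moreover have "?g a div 6 \<le> d a" using g6[of a] b by (auto simp: d_def)
          ultimately show ?thesis using b cnt_True_le by simp
        qed (auto simp: cnt_def)
        have "cnt (b (-1)) (d (-1)) = cnt (?b (-1)) (?g (-1) div 6)"
          "cnt (b 1) (d 1) = cnt (?b 1) (?g 1 div 6)"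
          using sum le[OF insertI1] le[OF insertI2[OF singletonI]] by linarith+
        then show ?thesis by (intro termwise) blast
      next
        case False
        have d6: "d a = ?g a div 6" if "b a" for a using that False by (simp add: b_def d_def)
        show ?thesis
        proof (cases "\<exists>a \<in> {-1, 1}. 3 dvd off a \<and> \<not> 2 ^ Suc k dvd off a")
          case True
          then obtain a1 where a1: "a1 \<in> {-1, 1}" "3 dvd off a1" "\<not> 2 ^ Suc k dvd off a1" by blast
          have a01: "a0 = -1 \<and> a1 = 1 \<or> a0 = 1 \<and> a1 = -1" using a0 a1 by auto
          have b1: "b a1" using a1 r[OF a1(1)] by (auto simp: b_def)
          have sum': "cnt (b a0) (d a0) + cnt (b a1) (d a1) =
              cnt (?b a0) (?g a0 div 6) + cnt (?b a1) (?g a1 div 6)"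
            using a01 sum by (elim disjE) simp_all
          \<comment> \<open>Equal totals would force equal gcds for the two slopes, whose 2-parts differ.\<close>
          have "cnt (?b a1) (?g a1 div 6) = 0" using a1(3) by (simp add: cnt_def)
          moreover have "cnt (b a1) (d a1) = cnt True (?g a1 div 6)" using b1 d6[OF b1] by simp
          moreover have "cnt (?b a0) (?g a0 div 6) = cnt True (?g a0 div 6)" using a0 by simp
          moreover have "cnt (b a0) (d a0) = 0 \<or> cnt (b a0) (d a0) = cnt True (?g a0 div 6)"
            using d6[of a0] by (cases "b a0") (simp_all add: cnt_def)
          moreover have "cnt True (?g a1 div 6) > 0" by (simp add: cnt_def)
          ultimately have "cnt True (?g a0 div 6) = cnt True (?g a1 div 6)" using sum' by linarith
          then have "?g a0 div 6 = ?g a1 div 6"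
            using cnt_True_eq_iff g6[OF a0(2)] g6[OF a1(2)] by blast
          then have "?g a0 = ?g a1" using g6[OF a0(2)] g6[OF a1(2)] by linarith
          moreover have "2 ^ Suc k dvd ?g a0" using a0(3) kc(1) by simp
          ultimately have "2 ^ Suc k dvd off a1" by (metis dvd_trans gcd_dvd1)
          with a1(3) show ?thesis by blast
        next
          case none: False
          have le: "cnt (b a) (d a) \<le> cnt (?b a) (?g a div 6)" if a: "a \<in> {-1, 1}" for a
          proof (cases "b a")
            case True
            then have "?b a" using none a by (auto simp: b_def)
            then show ?thesis using True d6 by simp
          qed (simp add: cnt_def)
          have "cnt (b (-1)) (d (-1)) = cnt (?b (-1)) (?g (-1) div 6)"
            "cnt (b 1) (d 1) = cnt (?b 1) (?g 1 div 6)"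
            using sum le[OF insertI1] le[OF insertI2[OF singletonI]] by linarith+
          then show ?thesis by (intro termwise) blast
        qed
      qed
    qed
  qed
  then show "shape a (a \<in> {a \<in> {-1, 1}. cond_B \<Gamma> m l h a}) (?g a div 6)" if "a \<in> {-1, 1}" for a
    using B[OF that] that by auto
qed blast

text \<open>No offset contains the full power of 2 of \<open>m\<close>. With even \<open>l\<close>,
  this leaves no code if \<open>s0\<close> is half of \<open>m\<close> times \<open>s\<close>, so
  the given code places \<open>s0\<close> at half of \<open>l\<close>; there the same fact selects a
  sixth of the gcd.\<close>

lemma codes_B3:
  assumes m: "6 dvd m" and iso: "isoX3 \<Gamma> m l h"
    and kc: "int m = 2 ^ Suc k * c" "odd c"
    and hl: "2 ^ Suc k dvd int h" "\<not> 2 ^ Suc k dvd int l" "even l"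
    and ex: "perfect_code \<Gamma> C0"
  shows "{C. perfect_code \<Gamma> C \<and> \<one> \<in> C} =
    code_family {a \<in> {-1, 1}. cond_B \<Gamma> m l h a} (\<lambda>a. gcd (off a) (int m) div 6)"
proof (rule perfect_codes_family)
  have m3: "3 dvd m" using m by presburger
  have off: "\<not> 2 ^ Suc k dvd off a" for a
  proof
    assume "2 ^ Suc k dvd off a"
    then have "2 ^ Suc k dvd off a + a * int h" using hl(1) by (intro dvd_add dvd_mult)
    then show False using hl(2) by simp
  qed
  obtain x y where xy: "pt x y True = \<one>" using isoX23_not_direct iso by blast
  obtain x0 l' where x0: "pt x0 l' True = \<one>" "int l = 2 * l'"
  proof (rule s0_location[OF xy])
    fix m' assume m': "int m = 2 * m'" "pt m' 0 True = \<one>"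
    have "codes a = {}" if "a \<in> {-1, 1}" for a
      using shape_half_m[OF that m3 kc m'(2,1)] off[of a] hl(3) unfolding shape_def by simp
    then have "{C. perfect_code \<Gamma> C \<and> \<one> \<in> C} = {}" unfolding perfect_codes_eq by simp
    with ex_code_through_one[OF ex] show thesis by blast
  qed
  fix a :: int assume a: "a \<in> {-1, 1}"
  have r: "\<not> 2 ^ Suc k dvd x0 - a * l'" using shape_half_l(2)[OF a m3 kc x0] off[of a] by blast
  show "shape a (a \<in> {a \<in> {-1, 1}. cond_B \<Gamma> m l h a}) (gcd (off a) (int m) div 6)"
  proof (rule shape_cong[OF shape_half_l(1)[OF a m3 kc x0]])
    show "(3 dvd off a \<and> (even l' \<longrightarrow> \<not> 2 ^ Suc k dvd x0 - a * l')) =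
        (a \<in> {a \<in> {-1, 1}. cond_B \<Gamma> m l h a})"
      unfolding mem_Collect_eq cond_B_iff[OF kc m] using iso hl a r by blast
  qed (use r in simp)
qed blast

theorem codes_A:
  assumes "{a \<in> {-1, 1}. cond_A \<Gamma> m l h a} \<noteq> {}"
  shows "{C. perfect_code \<Gamma> C \<and> \<one> \<in> C} =
    code_family {a \<in> {-1, 1}. cond_A \<Gamma> m l h a} (\<lambda>a. gcd (off a) (int m) div 3)"
proof -
  obtain a where a: "cond_A \<Gamma> m l h a" using assms by blast
  then have m: "6 dvd m" unfolding cond_A_def by blast
  then have "even (int m)" by presburger
  then obtain k c where kc: "int m = 2 ^ Suc k * c" "odd c"
    using int_even_decompose[of "int m"] m_pos by auto
  from a consider "isoX1 \<Gamma> m l h" | "isoX2 \<Gamma> m l h" "odd l"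
    | "isoX3 \<Gamma> m l h" "even h" "k = 0" "even l" "\<not> 4 dvd int l"
    unfolding cond_A_iff[OF kc m] by blast
  then show ?thesis
  proof cases
    case 3
    then have "int m = 2 * c" using kc by simp
    with 3 show ?thesis using codes_A3[OF m] kc(2) by blast
  qed (use codes_A1[OF m] codes_A2[OF m] in blast)+
qed

theorem codes_B:
  assumes "{a \<in> {-1, 1}. cond_B \<Gamma> m l h a} \<noteq> {}" and "\<exists>C. perfect_code \<Gamma> C"
  shows "{C. perfect_code \<Gamma> C \<and> \<one> \<in> C} =
    code_family {a \<in> {-1, 1}. cond_B \<Gamma> m l h a} (\<lambda>a. gcd (off a) (int m) div 6)"
proof -
  obtain a where a: "a \<in> {-1, 1}" "cond_B \<Gamma> m l h a" using assms(1) by blast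
  then have m: "6 dvd m" unfolding cond_B_def by blast
  then have "even (int m)" by presburger
  then obtain k c where kc: "int m = 2 ^ Suc k * c" "odd c"
    using int_even_decompose[of "int m"] m_pos by auto
  from a(2) consider
      "isoX2 \<Gamma> m l h" "even h" "even l" "3 dvd off a" "2 ^ Suc k dvd off a"
    | "isoX3 \<Gamma> m l h" "2 ^ Suc k dvd int h" "\<not> 2 ^ Suc k dvd int l" "even l"
    unfolding cond_B_iff[OF kc m] by blast
  then show ?thesis
  proof cases
    case 1
    show ?thesis by (rule codes_B2[OF m 1(1-3) kc a(1) 1(4,5)])
  next
    case 2
    obtain C0 where "perfect_code \<Gamma> C0" using assms(2) by blast
    then show ?thesis by (rule codes_B3[OF m 2(1) kc 2(2-4)])
  qed
qed

end

theorem theorem1p2: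
  fixes G :: "('g, 'b) monoid_scheme" (structure)
    and S :: "'g set" and s s' s0 :: 'g
    and m l h :: nat and \<Gamma> :: "'g graph" and I_A I_B :: "int set"
  assumes "comm_group G" and "finite (carrier G)"
    and "S = {s, inv s, s', inv s', s0}"
    and "S \<subseteq> carrier G - {\<one>}"
    and "generate G S = carrier G"
    and "card S = 5"
    and "group.ord G s0 = 2"
    and "\<Gamma> = Cay G S"
    and "m = group.ord G s"
    and "l = (LEAST k::nat. 0 < k \<and> s' [^] k \<in> generate G {s})"
    and "h < m" and "s [^] h \<otimes> s' [^] l = \<one>"
    and "\<exists>C. perfect_code \<Gamma> C"
    and "I_A = {a \<in> {-1, 1}. cond_A \<Gamma> m l h a}"
    and "I_B = {a \<in> {-1, 1}. cond_B \<Gamma> m l h a}"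
  shows
    "(I_A \<noteq> {} \<longrightarrow>
        {C. perfect_code \<Gamma> C \<and> \<one> \<in> C} =
        {\<Union>i \<in> {0..gcd (int l - a * int h) (int m) div 3 - 1}. Dset G s s' s0 a i (j i)
           | a (j :: int \<Rightarrow> int). a \<in> I_A \<and> j 0 = 0 \<and> (\<forall>i. j i \<in> {0, 1})}) \<and>
     (I_B \<noteq> {} \<longrightarrow>
        {C. perfect_code \<Gamma> C \<and> \<one> \<in> C} =
        {\<Union>i \<in> {0..gcd (int l - a * int h) (int m) div 6 - 1}. Dset G s s' s0 a i (j i)
           | a (j :: int \<Rightarrow> int). a \<in> I_B \<and> j 0 = 0 \<and> (\<forall>i. j i \<in> {0, 1})})"
proof -
  have cay: "cay5 G s s' s0 m l h"
    using assms(1-7,9,10,12) by (intro cay5I) simp_all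
  interpret cay5 G s s' s0 m l h by (rule cay)
  have \<Gamma>: "\<Gamma> = Cay G {s, inv s, s', inv s', s0}" using assms(3,8) by simp
  show ?thesis
    using codes_A codes_B assms(13) unfolding \<Gamma> assms(14,15) code_family_def by blast
qed

end
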